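(* Let ${\rm s}\in[-1,1]$ and $a\in\mathbb R\setminus\{0\}$. The scaling map $\Gamma_{{\rm s},a}$ is completely positive (it is implemented by a completely positive trace-preserving map on states of the mode) in the cases (i) ${\rm s}\in[-1,1]$ and $|a|=1$; (ii) ${\rm s}=-1$ and $|a|>1$; (iii) ${\rm s}=1$ and $|a|<1$. For all other values of $({\rm s},a)$ the scaling map $\Gamma_{{\rm s},a}$ is not even positive.
   Context: Consider a single bosonic mode with annihilation operator $\hat a$, $[\hat a,\hat a^\dagger]=1$, and displacement operators $\mathcal D(\xi)=\exp[\xi\hat a^\dagger-\xi^*\hat a]$, $\xi\in\mathbb C$. For a density operator $\hat\rho$ and ${\rm s}\in[-1,1]$, the ${\rm s}$-ordered characteristic function is $\chi_{\rm s}(\xi;\hat\rho)=\exp[\tfrac12{\rm s}|\xi|^2]\,\mathrm{Tr}(\hat\rho\,\mathcal D(\xi))$, and the ${\rm s}$-ordered quasiprobability is $\Lambda_{\rm s}(\alpha;\hat\rho)=\pi^{-1}\int \exp[\alpha\xi^*-\alpha^*\xi]\chi_{\rm s}(\xi;\hat\rho)\,d^2\xi$ (${\rm s}=1,0,-1$ give the $P$, Wigner and $Q$ functions). For $a\in\mathbb R\setminus\{0\}$ the scaling map $\Gamma_{{\rm s},a}$ is defined by $\Lambda_{\rm s}(\alpha;\Gamma_{{\rm s},a}(\hat\rho))=a^{-2}\Lambda_{\rm s}(a^{-1}\alpha;\hat\rho)$, equivalently $\chi_{\rm s}(\xi;\Gamma_{{\rm s},a}(\hat\rho))=\chi_{\rm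 s}(a\xi;\hat\rho)$. The map is positive if for every density operator $\hat\rho$ the function $\xi\mapsto\chi_{\rm s}(a\xi;\hat\rho)$ is the ${\rm s}$-ordered characteristic function of some density operator; it is completely positive if there is a completely positive trace-preserving linear map $\Phi$ on trace-class operators of the mode with $\chi_{\rm s}(\xi;\Phi(\hat\rho))=\chi_{\rm s}(a\xi;\hat\rho)$ for all density operators $\hat\rho$. *)

theory Defs
  imports Complex_Main
begin

text \<open>Single bosonic mode, represented in the Fock (number) basis |0>, |1>, ...
  of l2(nat). Operators are infinite matrices indexed by nat.\<close>

type_synonym cmat = "nat \<Rightarrow> nat \<Rightarrow> complex"

definition hermitian_mat :: "cmat \<Rightarrow> bool" where
  "hermitian_mat A \<longleftrightarrow> (\<forall>m n. A m n = cnj (A n m))"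

definition psd_mat :: "cmat \<Rightarrow> bool" where
  "psd_mat A \<longleftrightarrow> hermitian_mat A \<and>
     (\<forall>(N::nat) (v::nat \<Rightarrow> complex).
        0 \<le> Re (\<Sum>m<N. \<Sum>n<N. cnj (v m) * A m n * v n))"

definition mat_trace :: "cmat \<Rightarrow> complex" where
  "mat_trace A = (\<Sum>n. A n n)"

definition pos_tc :: "cmat \<Rightarrow> bool" where
  "pos_tc A \<longleftrightarrow> psd_mat A \<and> summable (\<lambda>n. A n n)"

definition trace_class :: "cmat \<Rightarrow> bool" where
  "trace_class A \<longleftrightarrow> (\<exists>P1 P2 P3 P4. pos_tc P1 \<and> pos_tc P2 \<and> pos_tc P3 \<and> pos_tc P4 \<and>
      A = (\<lambda>m n. P1 m n - P2 m n + \<i> * (P3 m n - P4 m n)))"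

definition density_op :: "cmat \<Rightarrow> bool" where
  "density_op \<rho> \<longleftrightarrow> pos_tc \<rho> \<and> mat_trace \<rho> = 1"

text \<open>Fock matrix elements <m| D(xi) |n> of the displacement operator
  D(xi) = exp(xi a^dagger - cnj xi a) = exp(-|xi|^2/2) exp(xi a^dagger) exp(-cnj xi a).\<close>
definition disp :: "complex \<Rightarrow> cmat" where
  "disp \<xi> m n = exp (- complex_of_real ((cmod \<xi>)\<^sup>2 / 2)) *
     (\<Sum>k\<le>min m n. complex_of_real (sqrt (fact m * fact n) / (fact k * fact (m - k) * fact (n - k)))
        * \<xi> ^ (m - k) * (- cnj \<xi>) ^ (n - k))"

definition tr_mul :: "cmat \<Rightarrow> cmat \<Rightarrow> complex" where
  "tr_mul \<rho> B = (\<Sum>n. \<Sum>m. \<rho> n m * B m n)"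

definition chi :: "real \<Rightarrow> complex \<Rightarrow> cmat \<Rightarrow> complex" where
  "chi s \<xi> \<rho> = complex_of_real (exp (s * (cmod \<xi>)\<^sup>2 / 2)) * tr_mul \<rho> (disp \<xi>)"

text \<open>Block operators on C^k (x) l2: X i j is the (i,j) block (i,j < k).\<close>
definition pos_tc_block :: "nat \<Rightarrow> (nat \<Rightarrow> nat \<Rightarrow> cmat) \<Rightarrow> bool" where
  "pos_tc_block k X \<longleftrightarrow>
     (\<forall>i<k. \<forall>j<k. \<forall>m n. X i j m n = cnj (X j i n m)) \<and>
     (\<forall>(N::nat) (v::nat \<Rightarrow> nat \<Rightarrow> complex).
        0 \<le> Re (\<Sum>i<k. \<Sum>j<k. \<Sum>m<N. \<Sum>n<N. cnj (v i m) * X i j m n * v j n)) \<and>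
     (\<forall>i<k. summable (\<lambda>m. X i i m m))"

definition cptp :: "(cmat \<Rightarrow> cmat) \<Rightarrow> bool" where
  "cptp \<Phi> \<longleftrightarrow>
     (\<forall>A B (c::complex). trace_class A \<and> trace_class B \<longrightarrow>
        \<Phi> (\<lambda>m n. c * A m n + B m n) = (\<lambda>m n. c * \<Phi> A m n + \<Phi> B m n)) \<and>
     (\<forall>A. trace_class A \<longrightarrow> trace_class (\<Phi> A) \<and> mat_trace (\<Phi> A) = mat_trace A) \<and>
     (\<forall>k X. pos_tc_block k X \<longrightarrow> pos_tc_block k (\<lambda>i j. \<Phi> (X i j)))"

definition scaling_positive :: "real \<Rightarrow> real \<Rightarrow> bool" where
  "scaling_positive s a \<longleftrightarrow>
     (\<forall>\<rho>. density_op \<rho> \<longrightarrow>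
        (\<exists>\<sigma>. density_op \<sigma> \<and> (\<forall>\<xi>. chi s \<xi> \<sigma> = chi s (complex_of_real a * \<xi>) \<rho>)))"

definition scaling_CP :: "real \<Rightarrow> real \<Rightarrow> bool" where
  "scaling_CP s a \<longleftrightarrow>
     (\<exists>\<Phi>. cptp \<Phi> \<and>
        (\<forall>\<rho>. density_op \<rho> \<longrightarrow> (\<forall>\<xi>. chi s \<xi> (\<Phi> \<rho>) = chi s (complex_of_real a * \<xi>) \<rho>)))"

end

(*
  Write D = disp for the displacement operators. Covariant channels are built from Kraus operators
  that shift the number basis: the attenuator (s = 1) multiplies the normally ordered and the
  amplifier (s = -1) the antinormally ordered displacement operator by the scaling \<xi> to a\<xi>, which
  is the binomial theorem and its negative counterpart on matrix entries. Passing from entries to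
  traces needs that D is an isometry: a contraction B satisfies
  |sum over n in S, m in T of \<rho>(n,m) B(m,n)|^2 <= tr_S \<rho> * tr_T \<rho> (Cholesky and Cauchy-Schwarz), so all
  traces are uniform limits of finite corners.

  For the remaining parameters, rescaling the Fock state |i> gives a radial characteristic function
  (1 - i a^2 x) exp(-t x / 2), x = |\<xi>|^2, t = s + a^2 (1 - s). It would determine the number distribution
  of the output state through orthogonality of Laguerre polynomials: the vacuum (i = 0, |a| < 1)
  yields a negative probability of |1>, and |1> (|a| > 1) a negative probability of |0>.
*)
theory Submission
  imports Defs "HOL-Probability.Distributions"
begin

section \<open>Positive forms\<close>

text \<open>Everything is therefore compared on \<open>K\<close> x \<open>K\<close> corners with the
  error \<open>trunc_err A K\<close>. It depends on the state alone, so it also serves all truncated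
  Heisenberg duals of a displacement operator, and entrywise convergence of these duals suffices.
  The orderings s = 1 and s = -1 are special because there
  \<open>exp (s * (cmod \<xi>)\<^sup>2 / 2)\<close> cancels the Gaussian prefactor, leaving a
  product of two exponentials in the ladder operators. In the negative part l = (t + 1) / 2 is the
  decay rate after multiplication by the Laguerre weight exp (- x / 2). The input |0> gives |1> the
  weight (l - 1) / l^2, the input |1> gives |0> the weight (l - a^2) / l^2. Since 2 (l - 1) = (a^2 -
  1) (1 - s) and 2 (l - a^2) = (1 - a^2) (1 + s), these two signs settle exactly the remaining
  parameters.\<close>

definition pos_form :: "('i \<Rightarrow> 'i \<Rightarrow> complex) \<Rightarrow> bool" where
  "pos_form A \<longleftrightarrow> (\<forall>x y. A x y = cnj (A y x)) \<and>
     (\<forall>S v. finite S \<longrightarrow> 0 \<le> Re (\<Sum>x\<in>S. \<Sum>y\<in>S. cnj (v x) * A x y * v y))"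

lemma pos_form_herm: "pos_form A \<Longrightarrow> A x y = cnj (A y x)"
  unfolding pos_form_def by blast

lemma pos_form_nonneg:
  "pos_form A \<Longrightarrow> finite S \<Longrightarrow> 0 \<le> Re (\<Sum>x\<in>S. \<Sum>y\<in>S. cnj (v x) * A x y * v y)"
  unfolding pos_form_def by blast

lemma psd_mat_iff_pos_form: "psd_mat A \<longleftrightarrow> pos_form A"
proof
  assume A: "psd_mat A"
  show "pos_form A"
    unfolding pos_form_def
  proof (intro conjI allI impI)
    fix x y show "A x y = cnj (A y x)"
      using A unfolding psd_mat_def hermitian_mat_def by blast
  next
    fix S :: "nat set" and v :: "nat \<Rightarrow> complex"
    assume S: "finite S"
    then obtain N where N: "S \<subseteq> {..<N}"
      using finite_nat_iff_bounded by blast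
    define w where "w = (\<lambda>x. if x \<in> S then v x else 0)"
    have "(\<Sum>x\<in>S. \<Sum>y\<in>S. cnj (v x) * A x y * v y)
        = (\<Sum>x\<in>S. \<Sum>y\<in>S. cnj (w x) * A x y * w y)"
      by (intro sum.cong) (auto simp: w_def)
    also have "\<dots> = (\<Sum>x\<in>S. \<Sum>y<N. cnj (w x) * A x y * w y)"
      using N by (intro sum.cong sum.mono_neutral_left) (auto simp: w_def)
    also have "\<dots> = (\<Sum>x<N. \<Sum>y<N. cnj (w x) * A x y * w y)"
      using N by (intro sum.mono_neutral_left) (auto simp: w_def)
    finally show "0 \<le> Re (\<Sum>x\<in>S. \<Sum>y\<in>S. cnj (v x) * A x y * v y)"
      using A unfolding psd_mat_def by (simp only:)
  qed
next
  assume "pos_form A"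
  then show "psd_mat A"
    unfolding pos_form_def psd_mat_def hermitian_mat_def by blast
qed

lemma pos_form_diag:
  assumes "pos_form A"
  shows "Im (A x x) = 0" "0 \<le> Re (A x x)" "A x x = of_real (Re (A x x))"
proof -
  show 1: "Im (A x x) = 0"
    using pos_form_herm[OF assms, of x x] by (simp add: complex_eq_iff)
  show "0 \<le> Re (A x x)"
    using pos_form_nonneg[OF assms, of "{x}" "\<lambda>_. 1"] by simp
  show "A x x = of_real (Re (A x x))"
    using 1 by (simp add: complex_eq_iff)
qed

text \<open>On the vector with entry 1 at \<open>x\<close> and \<open>- r * cnj (A x y)\<close> at
  \<open>y\<close> the form is affine in \<open>r\<close>, with negative slope unless
  \<open>A x y = 0\<close>.\<close>

lemma pos_form_diag0:
  assumes "pos_form A" "A y y = 0"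
  shows "A x y = 0"
proof (cases "x = y")
  case False
  show ?thesis
  proof (rule ccontr)
    assume nz: "A x y \<noteq> 0"
    define c where "c = (cmod (A x y))\<^sup>2"
    have c: "c > 0" using nz by (simp add: c_def)
    \<comment> \<open>With this \<open>r\<close> the form takes the value -1.\<close>
    define r where "r = (Re (A x x) + 1) / (2 * c)"
    define v where "v = (\<lambda>z. if z = x then 1 else - complex_of_real r * cnj (A x y))"
    have h: "A y x = cnj (A x y)" using pos_form_herm[OF assms(1)] .
    have "0 \<le> Re (\<Sum>p\<in>{x,y}. \<Sum>q\<in>{x,y}. cnj (v p) * A p q * v q)"
      by (rule pos_form_nonneg[OF assms(1)]) simp
    also have "(\<Sum>p\<in>{x,y}. \<Sum>q\<in>{x,y}. cnj (v p) * A p q * v q)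
        = A x x - of_real r * (A x y * cnj (A x y)) - of_real r * (A x y * cnj (A x y))"
      using False assms(2) h by (simp add: v_def algebra_simps)
    also have "A x y * cnj (A x y) = of_real c"
      by (simp add: c_def complex_norm_square[symmetric])
    finally have "0 \<le> Re (A x x) - 2 * r * c" by (simp add: mult_ac)
    moreover have "2 * r * c = Re (A x x) + 1" using c by (simp add: r_def)
    ultimately show False by linarith
  qed
qed (use assms in simp)

text \<open>Completing the square: the new form at \<open>u\<close> is the minimum over
  \<open>t\<close> of the form \<open>A\<close> at \<open>u\<close> plus \<open>t\<close> times the
  \<open>j\<close>-th unit vector. For a pivot \<open>A j j = 0\<close> the quotient is 0 by
  convention, and nothing is subtracted.\<close>

lemma pos_form_schur:
  assumes A: "pos_form A"
  shows "pos_form (\<lambda>x y. A x y - A x j * A j y / A j j)"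
proof (cases "A j j = 0")
  case True
  with A show ?thesis by simp
next
  case False
  have jj: "cnj (A j j) = A j j" using pos_form_herm[OF A, of j j] by simp
  show ?thesis
    unfolding pos_form_def
  proof (intro conjI allI impI)
    fix x y
    show "A x y - A x j * A j y / A j j = cnj (A y x - A y j * A j x / A j j)"
      using pos_form_herm[OF A, of x y] pos_form_herm[OF A, of x j] pos_form_herm[OF A, of j y] jj
      by (simp add: mult.commute)
  next
    fix S :: "'a set" and v :: "'a \<Rightarrow> complex"
    assume S: "finite S"
    define u where "u = (\<lambda>x. if x \<in> S then v x else 0)"
    define T where "T = insert j S"
    have T: "finite T" "S \<subseteq> T" "j \<in> T" using S by (auto simp: T_def)
    define b where "b = (\<Sum>y\<in>T. A j y * u y)"
    \<comment> \<open>The minimiser: it makes the coefficient \<open>b + A j j * t\<close> of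
      \<open>cnj t\<close> vanish.\<close>
    define t where "t = - b / A j j"
    have cb: "cnj b = (\<Sum>x\<in>T. cnj (u x) * A x j)"
      unfolding b_def cnj_sum using pos_form_herm[OF A, of _ j]
      by (intro sum.cong) (auto simp: mult.commute)
    have "(\<Sum>x\<in>T. \<Sum>y\<in>T. cnj (u x + (if x = j then t else 0)) * A x y * (u y + (if y = j then t else 0)))
       = (\<Sum>x\<in>T. cnj (u x + (if x = j then t else 0)) * ((\<Sum>y\<in>T. A x y * u y) + A x j * t))"
    proof (intro sum.cong refl)
      fix x
      define k where "k = cnj (u x + (if x = j then t else 0))"
      have "(\<Sum>y\<in>T. k * A x y * (u y + (if y = j then t else 0)))
          = (\<Sum>y\<in>T. k * (A x y * u y) + (if y = j then k * (A x j * t) else 0))"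
        by (intro sum.cong) (auto simp: algebra_simps)
      also have "\<dots> = k * ((\<Sum>y\<in>T. A x y * u y) + A x j * t)"
        using T by (simp add: sum.distrib sum_distrib_left[symmetric] distrib_left)
      finally show "(\<Sum>y\<in>T. k * A x y * (u y + (if y = j then t else 0))) = \<dots>" .
    qed
    also have "\<dots> = (\<Sum>x\<in>T. cnj (u x) * (\<Sum>y\<in>T. A x y * u y)) + t * cnj b + cnj t * (b + A j j * t)"
    proof -
      have "(\<Sum>x\<in>T. cnj (u x + (if x = j then t else 0)) * ((\<Sum>y\<in>T. A x y * u y) + A x j * t))
         = (\<Sum>x\<in>T. cnj (u x) * (\<Sum>y\<in>T. A x y * u y) + t * (cnj (u x) * A x j)
             + (if x = j then cnj t * ((\<Sum>y\<in>T. A x y * u y) + A x j * t) else 0))"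
        by (intro sum.cong) (auto simp: algebra_simps)
      then show ?thesis using T
        by (simp only: sum.distrib sum_distrib_left[symmetric] cb[symmetric] b_def[symmetric] sum.delta if_True)
    qed
    also have "b + A j j * t = 0" using False by (simp add: t_def)
    also have "t * cnj b = - (\<Sum>x\<in>T. \<Sum>y\<in>T. cnj (u x) * (A x j * A j y / A j j) * u y)"
    proof -
      have "t * cnj b = - ((\<Sum>x\<in>T. cnj (u x) * A x j) * (\<Sum>y\<in>T. A j y * u y / A j j))"
        unfolding cb by (simp add: t_def b_def sum_divide_distrib)
      also have "\<dots> = - (\<Sum>x\<in>T. \<Sum>y\<in>T. cnj (u x) * A x j * (A j y * u y / A j j))"
        by (simp only: sum_product)
      finally show ?thesis by (simp add: mult_ac)
    qed
    finally have eq: "(\<Sum>x\<in>T. \<Sum>y\<in>T. cnj (u x + (if x = j then t else 0)) * A x y * (u y + (if y = j then t else 0)))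
       = (\<Sum>x\<in>T. \<Sum>y\<in>T. cnj (u x) * (A x y - A x j * A j y / A j j) * u y)"
      by (simp add: sum_distrib_left sum_subtractf algebra_simps)
    have "(\<Sum>x\<in>S. \<Sum>y\<in>S. cnj (v x) * (A x y - A x j * A j y / A j j) * v y)
        = (\<Sum>x\<in>S. \<Sum>y\<in>S. cnj (u x) * (A x y - A x j * A j y / A j j) * u y)"
      by (intro sum.cong) (auto simp: u_def)
    also have "\<dots> = (\<Sum>x\<in>S. \<Sum>y\<in>T. cnj (u x) * (A x y - A x j * A j y / A j j) * u y)"
      using T by (intro sum.cong sum.mono_neutral_left) (auto simp: u_def)
    also have "\<dots> = (\<Sum>x\<in>T. \<Sum>y\<in>T. cnj (u x) * (A x y - A x j * A j y / A j j) * u y)"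
      using T by (intro sum.mono_neutral_left) (auto simp: u_def)
    finally show "0 \<le> Re (\<Sum>x\<in>S. \<Sum>y\<in>S. cnj (v x) * (A x y - A x j * A j y / A j j) * v y)"
      using pos_form_nonneg[OF A T(1), of "\<lambda>x. u x + (if x = j then t else 0)"] by (simp only: eq)
  qed
qed

text \<open>Each pivot splits off a rank-one form and leaves the Schur complement, whose row and
  column at the pivot vanish. The remainder \<open>A'\<close> is part of the claim because the
  induction continues on it.\<close>

lemma pos_form_partial_cholesky:
  fixes A :: cmat
  assumes "pos_form A"
  shows "\<exists>l A'. pos_form A' \<and> (\<forall>m n. m < N \<or> n < N \<longrightarrow> A' m n = 0) \<and>
           (\<forall>m n. A m n = (\<Sum>j<N. l j m * cnj (l j n)) + A' m n)"
proof (induction N)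
  case 0
  show ?case using assms by (intro exI[of _ A] exI) auto
next
  case (Suc N)
  then obtain l A' where p: "pos_form A'" and z: "\<And>m n. m < N \<or> n < N \<Longrightarrow> A' m n = 0"
    and e: "\<And>m n. A m n = (\<Sum>j<N. l j m * cnj (l j n)) + A' m n" by blast
  define d where "d = Re (A' N N)"
  have d: "A' N N = of_real d" "d \<ge> 0" using pos_form_diag[OF p, of N] by (auto simp: d_def)
  define A'' where "A'' = (\<lambda>m n. A' m n - A' m N * A' N n / A' N N)"
  define l' where "l' = l(N := (\<lambda>m. A' m N / of_real (sqrt d)))"
  have "pos_form A''" unfolding A''_def by (rule pos_form_schur[OF p])
  moreover have "A'' m n = 0" if "m < Suc N \<or> n < Suc N" for m n
  \<comment> \<open>A zero pivot already has zero row and column, and the column \<open>l' N\<close>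
    is then zero through division by \<open>sqrt 0\<close>, so singular forms need no separate
    treatment.\<close>
  proof (cases "d = 0")
    case True
    then have "A' x N = 0" for x using pos_form_diag0[OF p] d by simp
    moreover from this have "A' N x = 0" for x using pos_form_herm[OF p, of N x] by simp
    ultimately show ?thesis using z[of m n] that by (auto simp: A''_def less_Suc_eq)
  next
    case False
    then show ?thesis using z[of m n] z[of m N] z[of N n] that d by (auto simp: A''_def less_Suc_eq)
  qed
  moreover have "A m n = (\<Sum>j<Suc N. l' j m * cnj (l' j n)) + A'' m n" for m n
  proof -
    have "A' N n = cnj (A' n N)" using pos_form_herm[OF p] .
    moreover have "of_real (sqrt d) * of_real (sqrt d) = complex_of_real d"
      using d(2) by (metis of_real_mult real_sqrt_mult_self abs_of_nonneg)
    ultimately have "l' N m * cnj (l' N n) = A' m N * A' N n / A' N N"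
      using d by (simp add: l'_def)
    moreover have "(\<Sum>j<N. l' j m * cnj (l' j n)) = (\<Sum>j<N. l j m * cnj (l j n))"
      by (intro sum.cong) (auto simp: l'_def)
    ultimately show ?thesis using e[of m n] by (simp add: A''_def)
  qed
  ultimately show ?case by blast
qed

lemma pos_form_cholesky:
  fixes A :: cmat
  assumes "pos_form A"
  obtains l where "\<And>m n. m < N \<Longrightarrow> n < N \<Longrightarrow> A m n = (\<Sum>j<N. l j m * cnj (l j n))"
proof -
  obtain l A' where "\<And>m n. m < N \<or> n < N \<Longrightarrow> A' m n = 0"
    and "\<And>m n. A m n = (\<Sum>j<N. l j m * cnj (l j n)) + A' m n"
    using pos_form_partial_cholesky[OF assms, of N] by blast
  then show ?thesis by (intro that[of l]) simp
qed

text \<open>A congruence by the matrix whose column \<open>x\<close> has the single entry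
  \<open>c x\<close>, in row \<open>f x\<close>. As \<open>f\<close> may fail to be injective, a
  test vector is pushed forward by summing over the fibres of \<open>f\<close>. Each Kraus term has
  this shape, and so has restriction to a diagonal block.\<close>

lemma pos_form_pullback:
  assumes A: "pos_form A"
  shows "pos_form (\<lambda>x y. cnj (c x) * A (f x) (f y) * c y)"
  unfolding pos_form_def
proof (intro conjI allI impI)
  fix x y
  show "cnj (c x) * A (f x) (f y) * c y = cnj (cnj (c y) * A (f y) (f x) * c x)"
    using pos_form_herm[OF A, of "f x" "f y"] by simp
next
  fix S :: "'b set" and v :: "'b \<Rightarrow> complex"
  assume S: "finite S"
  define w where "w = (\<lambda>p. \<Sum>x | x \<in> S \<and> f x = p. c x * v x)"
  have "(\<Sum>p\<in>f ` S. \<Sum>q\<in>f ` S. cnj (w p) * A p q * w q)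
     = (\<Sum>p\<in>f ` S. \<Sum>x | x \<in> S \<and> f x = p. \<Sum>q\<in>f ` S. \<Sum>y | y \<in> S \<and> f y = q. cnj (c x * v x) * A (f x) (f y) * (c y * v y))"
  proof (intro sum.cong refl)
    fix p
    have "(\<Sum>q\<in>f ` S. cnj (w p) * A p q * w q)
      = (\<Sum>q\<in>f ` S. \<Sum>x | x \<in> S \<and> f x = p. \<Sum>y | y \<in> S \<and> f y = q. cnj (c x * v x) * A p q * (c y * v y))"
      by (simp only: w_def cnj_sum sum_distrib_right[of _ _ "A p _"] sum_product)
    also have "\<dots> = (\<Sum>x | x \<in> S \<and> f x = p. \<Sum>q\<in>f ` S. \<Sum>y | y \<in> S \<and> f y = q. cnj (c x * v x) * A p q * (c y * v y))"
      by (rule sum.swap)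
    also have "\<dots> = (\<Sum>x | x \<in> S \<and> f x = p. \<Sum>q\<in>f ` S. \<Sum>y | y \<in> S \<and> f y = q. cnj (c x * v x) * A (f x) (f y) * (c y * v y))"
      by (intro sum.cong) auto
    finally show "(\<Sum>q\<in>f ` S. cnj (w p) * A p q * w q) = \<dots>" .
  qed
  also have "\<dots> = (\<Sum>p\<in>f ` S. \<Sum>x | x \<in> S \<and> f x = p. \<Sum>y\<in>S. cnj (c x * v x) * A (f x) (f y) * (c y * v y))"
    by (simp only: sum.image_gen[OF S, symmetric, where g = f])
  also have "\<dots> = (\<Sum>x\<in>S. \<Sum>y\<in>S. cnj (c x * v x) * A (f x) (f y) * (c y * v y))"
    by (rule sum.image_gen[OF S, symmetric])
  also have "\<dots> = (\<Sum>x\<in>S. \<Sum>y\<in>S. cnj (v x) * (cnj (c x) * A (f x) (f y) * c y) * v y)"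
    by (simp add: mult_ac)
  finally show "0 \<le> Re (\<Sum>x\<in>S. \<Sum>y\<in>S. cnj (v x) * (cnj (c x) * A (f x) (f y) * c y) * v y)"
    using pos_form_nonneg[OF A, of "f ` S" w] S by (simp only: finite_imageI)
qed

lemma pos_form_suminf:
  assumes "\<And>k. pos_form (A k)" "\<And>x y. summable (\<lambda>k. A k x y)"
  shows "pos_form (\<lambda>x y. \<Sum>k. A k x y)"
  unfolding pos_form_def
proof (intro conjI allI impI)
  fix x y
  have "A k x y = cnj (A k y x)" for k using pos_form_herm[OF assms(1)] .
  then show "(\<Sum>k. A k x y) = cnj (\<Sum>k. A k y x)"
    using sums_cnj[of "\<lambda>k. A k y x" "\<Sum>k. A k y x"] assms(2)[of y x]
    by (simp add: sums_iff)
next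
  fix S :: "'a set" and v :: "'a \<Rightarrow> complex"
  assume S: "finite S"
  have "(\<lambda>k. \<Sum>x\<in>S. \<Sum>y\<in>S. cnj (v x) * A k x y * v y) sums
        (\<Sum>x\<in>S. \<Sum>y\<in>S. cnj (v x) * (\<Sum>k. A k x y) * v y)"
    by (intro sums_sum sums_mult sums_mult2 summable_sums assms)
  then have "(\<lambda>k. Re (\<Sum>x\<in>S. \<Sum>y\<in>S. cnj (v x) * A k x y * v y)) sums
        Re (\<Sum>x\<in>S. \<Sum>y\<in>S. cnj (v x) * (\<Sum>k. A k x y) * v y)"
    by (rule sums_Re)
  then show "0 \<le> Re (\<Sum>x\<in>S. \<Sum>y\<in>S. cnj (v x) * (\<Sum>k. A k x y) * v y)"
    by (rule sums_le[OF _ sums_zero, rotated 1]) (rule pos_form_nonneg[OF assms(1) S])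
qed

text \<open>This is nonnegativity of the diagonal entry at \<open>x\<close> of the Schur complement
  with pivot \<open>y\<close>.\<close>

lemma pos_form_CS:
  assumes A: "pos_form A"
  shows "(cmod (A x y))\<^sup>2 \<le> Re (A x x) * Re (A y y)"
proof (cases "A y y = 0")
  case True
  then show ?thesis using pos_form_diag0[OF A] by simp
next
  case False
  define d where "d = Re (A y y)"
  have d: "A y y = of_real d" "d \<ge> 0" using pos_form_diag[OF A, of y] by (auto simp: d_def)
  then have "d > 0" using False by (cases "d = 0") auto
  have "0 \<le> Re (A x x - A x y * A y x / A y y)"
    using pos_form_diag(2)[OF pos_form_schur[OF A, of y], of x] .
  also have "A x y * A y x = of_real ((cmod (A x y))\<^sup>2)"
    using pos_form_herm[OF A, of y x] by (simp add: complex_norm_square[symmetric])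
  finally have "(cmod (A x y))\<^sup>2 / d \<le> Re (A x x)" unfolding d by simp
  then show ?thesis using \<open>d > 0\<close> unfolding d_def[symmetric] by (simp add: field_simps)
qed

text \<open>Cauchy-Schwarz made linear in the diagonal. The free weights \<open>s\<close>,
  \<open>t\<close> later become Kraus coefficients, so that an off-diagonal Kraus sum is dominated
  by two diagonal ones.\<close>

lemma pos_form_AMGM:
  assumes A: "pos_form A"
  shows "cmod (A x y) * (s * t) \<le> s\<^sup>2 * Re (A x x) + t\<^sup>2 * Re (A y y)"
proof -
  define p q where "p = \<bar>s\<bar> * sqrt (Re (A x x))" and "q = \<bar>t\<bar> * sqrt (Re (A y y))"
  have "cmod (A x y) \<le> sqrt (Re (A x x)) * sqrt (Re (A y y))"
    using pos_form_CS[OF A, of x y] by (simp add: real_le_rsqrt flip: real_sqrt_mult)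
  then have "cmod (A x y) * (\<bar>s\<bar> * \<bar>t\<bar>) \<le> p * q"
    using mult_right_mono[of "cmod (A x y)" "sqrt (Re (A x x)) * sqrt (Re (A y y))" "\<bar>s\<bar> * \<bar>t\<bar>"]
    unfolding p_def q_def by (simp add: mult_ac)
  moreover have "cmod (A x y) * (s * t) \<le> cmod (A x y) * (\<bar>s\<bar> * \<bar>t\<bar>)"
    by (intro mult_left_mono) (auto simp flip: abs_mult)
  moreover have "p * q \<le> p\<^sup>2 + q\<^sup>2"
  proof -
    have "0 \<le> p" "0 \<le> q" using pos_form_diag(2)[OF A] by (simp_all add: p_def q_def)
    then have "0 \<le> p * q" by simp
    then show ?thesis using sum_squares_bound[of p q] by linarith
  qed
  ultimately show ?thesis using pos_form_diag(2)[OF A] by (simp add: p_def q_def power_mult_distrib)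
qed


section \<open>Traces against contractions\<close>

text \<open>Operator norm at most 1, tested on finitely supported vectors. Separate index sets
  \<open>S\<close> and \<open>T\<close> give bounds for rectangular corners, and only finite sums
  appear, so the property passes to entrywise limits.\<close>

definition contraction :: "cmat \<Rightarrow> bool" where
  "contraction B \<longleftrightarrow> (\<forall>S T u v. finite S \<longrightarrow> finite T \<longrightarrow>
     cmod (\<Sum>m\<in>S. \<Sum>n\<in>T. cnj (u m) * B m n * v n)
       \<le> L2_set (\<lambda>m. cmod (u m)) S * L2_set (\<lambda>n. cmod (v n)) T)"

lemma contractionD:
  "contraction B \<Longrightarrow> finite S \<Longrightarrow> finite T \<Longrightarrow>
     cmod (\<Sum>m\<in>S. \<Sum>n\<in>T. cnj (u m) * B m n * v n)
       \<le> L2_set (\<lambda>m. cmod (u m)) S * L2_set (\<lambda>n. cmod (v n)) T"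
  unfolding contraction_def by blast

lemma contraction_entry: "contraction B \<Longrightarrow> cmod (B m n) \<le> 1"
  using contractionD[of B "{m}" "{n}" "\<lambda>_. 1" "\<lambda>_. 1"] by simp

lemma contraction_LIMSEQ:
  assumes "\<And>N. contraction (B N)" "\<And>m n. (\<lambda>N. B N m n) \<longlonglongrightarrow> E m n"
  shows "contraction E"
  unfolding contraction_def
proof (intro allI impI)
  fix S T :: "nat set" and u v :: "nat \<Rightarrow> complex"
  assume S: "finite S" "finite T"
  have "(\<lambda>N. cmod (\<Sum>m\<in>S. \<Sum>n\<in>T. cnj (u m) * B N m n * v n))
        \<longlonglongrightarrow> cmod (\<Sum>m\<in>S. \<Sum>n\<in>T. cnj (u m) * E m n * v n)"
    by (intro tendsto_intros assms)
  then show "cmod (\<Sum>m\<in>S. \<Sum>n\<in>T. cnj (u m) * E m n * v n)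
       \<le> L2_set (\<lambda>m. cmod (u m)) S * L2_set (\<lambda>n. cmod (v n)) T"
    by (rule LIMSEQ_le_const2) (use contractionD[OF assms(1) S] in blast)
qed

text \<open>The product form of the bound is what makes it useful: it is small as soon as one of the
  two index sets lies far out, whatever the other one is.\<close>

lemma pos_form_contraction_bound:
  assumes A: "pos_form A" and B: "contraction B" and S: "finite S" and T: "finite T"
  shows "cmod (\<Sum>n\<in>S. \<Sum>m\<in>T. A n m * B m n)
    \<le> sqrt (\<Sum>n\<in>S. Re (A n n)) * sqrt (\<Sum>m\<in>T. Re (A m m))"
proof -
  obtain N where N: "S \<union> T \<subseteq> {..<N}" using S T finite_nat_iff_bounded[of "S \<union> T"] by blast
  obtain l where l: "\<And>m n. m < N \<Longrightarrow> n < N \<Longrightarrow> A m n = (\<Sum>j<N. l j m * cnj (l j n))"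
    using pos_form_cholesky[OF A, of N] by blast
  \<comment> \<open>The norm of the \<open>j\<close>-th Cholesky column restricted to
    \<open>U\<close>; the squares add up over \<open>j\<close> to the trace of \<open>A\<close> over
    \<open>U\<close>.\<close>
  define f where "f = (\<lambda>U j. L2_set (\<lambda>m. cmod (l j m)) U)"
  have f: "L2_set (f U) {..<N} = sqrt (\<Sum>m\<in>U. Re (A m m))" if "U \<subseteq> {..<N}" for U
  proof -
    have "(\<Sum>j<N. (f U j)\<^sup>2) = (\<Sum>j<N. \<Sum>m\<in>U. (cmod (l j m))\<^sup>2)"
      unfolding f_def L2_set_def by (simp add: sum_nonneg)
    also have "\<dots> = (\<Sum>m\<in>U. \<Sum>j<N. (cmod (l j m))\<^sup>2)" by (rule sum.swap)
    also have "\<dots> = (\<Sum>m\<in>U. Re (A m m))"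
    proof (intro sum.cong refl)
      fix m assume "m \<in> U"
      then have "A m m = (\<Sum>j<N. of_real ((cmod (l j m))\<^sup>2))"
        using that l[of m m] unfolding complex_norm_square by auto
      then show "(\<Sum>j<N. (cmod (l j m))\<^sup>2) = Re (A m m)" by simp
    qed
    finally show ?thesis unfolding L2_set_def by simp
  qed
  have "(\<Sum>n\<in>S. \<Sum>m\<in>T. A n m * B m n) = (\<Sum>n\<in>S. \<Sum>m\<in>T. \<Sum>j<N. cnj (l j m) * B m n * l j n)"
    using N by (intro sum.cong refl) (auto simp: l subset_eq sum_distrib_left mult_ac)
  also have "\<dots> = (\<Sum>n\<in>S. \<Sum>j<N. \<Sum>m\<in>T. cnj (l j m) * B m n * l j n)"
    by (intro sum.cong refl sum.swap)
  also have "\<dots> = (\<Sum>j<N. \<Sum>n\<in>S. \<Sum>m\<in>T. cnj (l j m) * B m n * l j n)"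
    by (rule sum.swap)
  also have "\<dots> = (\<Sum>j<N. \<Sum>m\<in>T. \<Sum>n\<in>S. cnj (l j m) * B m n * l j n)"
    by (intro sum.cong refl sum.swap)
  also have "cmod \<dots> \<le> (\<Sum>j<N. f T j * f S j)"
    unfolding f_def by (intro sum_norm_le contractionD B S T)
  also have "\<dots> \<le> (\<Sum>j<N. \<bar>f T j\<bar> * \<bar>f S j\<bar>)"
    by (intro sum_mono) (simp flip: abs_mult)
  also have "\<dots> \<le> L2_set (f T) {..<N} * L2_set (f S) {..<N}"
    by (rule L2_set_mult_ineq)
  finally show ?thesis using N by (simp add: f mult.commute)
qed

definition rtrace :: "cmat \<Rightarrow> real" where
  "rtrace A = (\<Sum>n. Re (A n n))"

definition tail :: "cmat \<Rightarrow> nat \<Rightarrow> real" where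
  "tail A K = rtrace A - (\<Sum>n<K. Re (A n n))"

lemma pos_tcD:
  assumes "pos_tc A"
  shows "pos_form A" "(\<lambda>n. Re (A n n)) sums rtrace A" "\<And>n. 0 \<le> Re (A n n)"
    "mat_trace A = of_real (rtrace A)"
proof -
  show p: "pos_form A" using assms unfolding pos_tc_def psd_mat_iff_pos_form by blast
  have s: "summable (\<lambda>n. A n n)" using assms unfolding pos_tc_def by blast
  then have s': "summable (\<lambda>n. Re (A n n))" by (rule summable_Re)
  then show t: "(\<lambda>n. Re (A n n)) sums rtrace A" unfolding rtrace_def by (rule summable_sums)
  show "0 \<le> Re (A n n)" for n using pos_form_diag[OF p] by blast
  have "(\<lambda>n. of_real (Re (A n n)) :: complex) sums of_real (rtrace A)"
    using t by (rule sums_of_real)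
  then show "mat_trace A = of_real (rtrace A)"
    unfolding mat_trace_def pos_form_diag(3)[OF p, symmetric] by (rule sums_unique[symmetric])
qed

lemma pos_tcI:
  assumes "pos_form A" "summable (\<lambda>n. Re (A n n))"
  shows "pos_tc A"
proof -
  have "summable (\<lambda>n. of_real (Re (A n n)) :: complex)"
    using assms(2) by (rule summable_of_real)
  then show ?thesis
    unfolding pos_tc_def psd_mat_iff_pos_form pos_form_diag(3)[OF assms(1), symmetric]
    using assms(1) by blast
qed

lemma tail_nonneg: "pos_tc A \<Longrightarrow> 0 \<le> tail A K"
  unfolding tail_def using sum_le_suminf[of "\<lambda>n. Re (A n n)" "{..<K}"] pos_tcD(2,3)[of A]
  by (simp add: sums_iff)

lemma rtrace_nonneg: "pos_tc A \<Longrightarrow> 0 \<le> rtrace A"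
  using tail_nonneg[of A 0] by (simp add: tail_def)

lemma tail_tendsto:
  assumes "pos_tc A"
  shows "(\<lambda>K. tail A K) \<longlonglongrightarrow> 0"
proof -
  have "(\<lambda>K. \<Sum>n<K. Re (A n n)) \<longlonglongrightarrow> rtrace A"
    using pos_tcD(2)[OF assms] by (simp add: sums_def)
  from tendsto_diff[OF tendsto_const[of "rtrace A"] this] show ?thesis
    unfolding tail_def by simp
qed

lemma sum_le_tail:
  assumes "pos_tc A"
  shows "(\<Sum>n\<in>{K..<M}. Re (A n n)) \<le> tail A K"
proof (cases "K \<le> M")
  case True
  then have "(\<Sum>n<M. Re (A n n)) = (\<Sum>n<K. Re (A n n)) + (\<Sum>n\<in>{K..<M}. Re (A n n))"
    using sum.atLeastLessThan_concat[of 0 K M "\<lambda>n. Re (A n n)"] by (simp add: lessThan_atLeast0)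
  then show ?thesis using tail_nonneg[OF assms, of M] unfolding tail_def by simp
next
  case False
  then show ?thesis using tail_nonneg[OF assms] by simp
qed

definition trunc :: "cmat \<Rightarrow> cmat \<Rightarrow> nat \<Rightarrow> nat \<Rightarrow> complex" where
  "trunc A B N M = (\<Sum>n<N. \<Sum>m<M. A n m * B m n)"

text \<open>Two strips, rows from \<open>K\<close> on and columns from \<open>K\<close> on, each
  contribute a root of the tail times a root of the full trace. The observable does not
  enter.\<close>

definition trunc_err :: "cmat \<Rightarrow> nat \<Rightarrow> real" where
  "trunc_err A K = 2 * sqrt (tail A K) * sqrt (rtrace A)"

lemma trunc_err_tendsto: "pos_tc A \<Longrightarrow> (\<lambda>K. trunc_err A K) \<longlonglongrightarrow> 0"
  unfolding trunc_err_def by (auto intro!: tendsto_eq_intros tail_tendsto)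

lemma trunc_diff:
  assumes A: "pos_tc A" and B: "contraction B" and K: "K \<le> N" "K \<le> M"
  shows "cmod (trunc A B N M - trunc A B K K) \<le> trunc_err A K"
proof -
  have 1: "{..<N} = {..<K} \<union> {K..<N}" "{..<M} = {..<K} \<union> {K..<M}" using K by auto
  have r: "(\<Sum>n<L. Re (A n n)) \<le> rtrace A" for L
    using tail_nonneg[OF A, of L] by (simp add: tail_def)
  \<comment> \<open>The L-shaped region outside the \<open>K\<close> x \<open>K\<close> corner is
    cut into two rectangles.\<close>
  have "trunc A B N M - trunc A B K K =
     (\<Sum>n\<in>{K..<N}. \<Sum>m\<in>{..<M}. A n m * B m n) + (\<Sum>n\<in>{..<K}. \<Sum>m\<in>{K..<M}. A n m * B m n)"
    unfolding trunc_def 1(1)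
    by (subst sum.union_disjoint) (auto simp: 1(2) sum.union_disjoint ivl_disj_int sum.distrib)
  also have "cmod \<dots> \<le> sqrt (\<Sum>n\<in>{K..<N}. Re (A n n)) * sqrt (\<Sum>n\<in>{..<M}. Re (A n n))
     + sqrt (\<Sum>n\<in>{..<K}. Re (A n n)) * sqrt (\<Sum>n\<in>{K..<M}. Re (A n n))"
    by (intro norm_triangle_mono pos_form_contraction_bound pos_tcD A B) auto
  also have "\<dots> \<le> sqrt (tail A K) * sqrt (rtrace A) + sqrt (rtrace A) * sqrt (tail A K)"
    by (intro add_mono mult_mono real_sqrt_le_mono sum_le_tail[OF A] r)
       (auto intro!: sum_nonneg tail_nonneg A pos_tcD(3)[OF A] rtrace_nonneg)
  finally show ?thesis by (simp add: trunc_err_def mult_ac)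
qed

text \<open>Convergence of the iterated series has to be proved along the way, since
  \<open>suminf\<close> of a divergent series carries no information: the rows are Cauchy by the
  rectangle bound, and the partial sums over rows are Cauchy by \<open>trunc_diff\<close>.\<close>

lemma tr_mul_trunc:
  assumes A: "pos_tc A" and B: "contraction B"
  shows "cmod (tr_mul A B - trunc A B K K) \<le> trunc_err A K"
proof -
  have inner: "summable (\<lambda>m. A n m * B m n)" for n
    unfolding summable_Cauchy
  proof (intro allI impI)
    fix e :: real assume e: "0 < e"
    define a where "a = sqrt (Re (A n n))"
    have "(\<lambda>K. a * sqrt (tail A K)) \<longlonglongrightarrow> 0"
      by (auto intro!: tendsto_eq_intros tail_tendsto A)
    then obtain K where K: "\<And>k. k \<ge> K \<Longrightarrow> a * sqrt (tail A k) < e"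
      using order_tendstoD(2)[of _ 0 sequentially e] e unfolding eventually_sequentially by blast
    have "norm (\<Sum>m\<in>{p..<q}. A n m * B m n) < e" if "p \<ge> K" for p q
    proof -
      \<comment> \<open>The rectangle bound for a single row and a segment of columns.\<close>
      have "norm (\<Sum>n\<in>{n}. \<Sum>m\<in>{p..<q}. A n m * B m n)
          \<le> sqrt (\<Sum>n\<in>{n}. Re (A n n)) * sqrt (\<Sum>m\<in>{p..<q}. Re (A m m))"
        by (intro pos_form_contraction_bound pos_tcD A B) auto
      also have "\<dots> \<le> a * sqrt (tail A p)"
        unfolding a_def by (auto intro!: mult_left_mono sum_le_tail A pos_tcD(3)[OF A])
      finally show ?thesis using K[OF that] by simp
    qed
    then show "\<exists>K. \<forall>p\<ge>K. \<forall>q. norm (\<Sum>m\<in>{p..<q}. A n m * B m n) < e" by blast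
  qed
  define R where "R = (\<lambda>N. \<Sum>n<N. \<Sum>m. A n m * B m n)"
  have lim: "(\<lambda>M. trunc A B N M) \<longlonglongrightarrow> R N" for N
    unfolding trunc_def R_def by (intro tendsto_sum summable_LIMSEQ inner)
  have RK: "cmod (R N - trunc A B K K) \<le> trunc_err A K" if "N \<ge> K" for N K
  proof (rule LIMSEQ_le_const2)
    show "(\<lambda>M. cmod (trunc A B N M - trunc A B K K)) \<longlonglongrightarrow> cmod (R N - trunc A B K K)"
      by (intro tendsto_intros lim)
    show "\<exists>L. \<forall>M\<ge>L. cmod (trunc A B N M - trunc A B K K) \<le> trunc_err A K"
      using trunc_diff[OF A B that] by blast
  qed
  have "Cauchy R"
    unfolding Cauchy_def
  proof (intro allI impI)
    fix e :: real assume e: "0 < e"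
    then obtain K where K: "trunc_err A K < e / 2"
      using order_tendstoD(2)[OF trunc_err_tendsto[OF A], of "e/2"] unfolding eventually_sequentially
      by (meson half_gt_zero le_refl)
    have "dist (R m) (R n) < e" if "m \<ge> K" "n \<ge> K" for m n
    proof -
      have "dist (R m) (R n) \<le> dist (R m) (trunc A B K K) + dist (R n) (trunc A B K K)"
        by (rule dist_triangle2)
      also have "\<dots> < e" using RK[OF that(1)] RK[OF that(2)] K by (simp add: dist_norm)
      finally show ?thesis .
    qed
    then show "\<exists>M. \<forall>m\<ge>M. \<forall>n\<ge>M. dist (R m) (R n) < e" by blast
  qed
  then obtain L where L: "R \<longlonglongrightarrow> L" using Cauchy_convergent convergentD by blast
  then have "tr_mul A B = L"
    unfolding tr_mul_def R_def by (intro sums_unique[symmetric]) (simp add: sums_def)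
  moreover have "cmod (L - trunc A B K K) \<le> trunc_err A K"
  proof (rule LIMSEQ_le_const2)
    show "(\<lambda>N. cmod (R N - trunc A B K K)) \<longlonglongrightarrow> cmod (L - trunc A B K K)"
      by (intro tendsto_intros L)
    show "\<exists>N. \<forall>M\<ge>N. cmod (R M - trunc A B K K) \<le> trunc_err A K" using RK by blast
  qed
  ultimately show ?thesis by simp
qed

lemma tr_mul_tendsto:
  assumes "pos_tc A" "contraction B"
  shows "(\<lambda>K. trunc A B K K) \<longlonglongrightarrow> tr_mul A B"
proof -
  have "(\<lambda>K. trunc A B K K - tr_mul A B) \<longlonglongrightarrow> 0"
    by (rule Lim_null_comparison[OF _ trunc_err_tendsto[OF assms(1)]])
       (use tr_mul_trunc[OF assms] in \<open>simp add: norm_minus_commute\<close>)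
  then show ?thesis by (simp add: LIM_zero_iff)
qed

lemma tr_mul_scale:
  assumes "pos_tc A" "contraction B" "contraction C" "\<And>m n. C m n = c * B m n"
  shows "tr_mul A C = c * tr_mul A B"
proof (rule LIMSEQ_unique[OF tr_mul_tendsto[OF assms(1,3)]])
  have "(\<lambda>K. c * trunc A B K K) \<longlonglongrightarrow> c * tr_mul A B"
    by (intro tendsto_intros tr_mul_tendsto assms)
  then show "(\<lambda>K. trunc A C K K) \<longlonglongrightarrow> c * tr_mul A B"
    by (simp add: trunc_def assms(4) sum_distrib_left mult_ac)
qed


section \<open>Shift-type quantum channels\<close>

lemma sum_over_fibres:
  fixes G :: "'a \<Rightarrow> 'c::semiring_0"
  assumes "finite S"
  shows "(\<Sum>x\<in>S. G x * (\<Sum>y\<in>Y. if g y = x then H y else 0)) = (\<Sum>y\<in>Y. if g y \<in> S then G (g y) * H y else 0)"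
proof -
  have "(\<Sum>x\<in>S. G x * (\<Sum>y\<in>Y. if g y = x then H y else 0)) = (\<Sum>x\<in>S. \<Sum>y\<in>Y. if g y = x then G (g y) * H y else 0)"
    by (auto simp: sum_distrib_left intro!: sum.cong)
  also have "\<dots> = (\<Sum>y\<in>Y. \<Sum>x\<in>S. if g y = x then G (g y) * H y else 0)"
    by (rule sum.swap)
  finally show ?thesis using assms by (simp only: sum.delta')
qed

text \<open>The \<open>k\<close>-th Kraus operator has entry \<open>c k m\<close> at position \<open>(m, f k m)\<close> and zeros elsewhere;
  the assumption says that the sum of all Kraus terms preserves the trace.\<close>

locale kraus_channel =
  fixes c :: "nat \<Rightarrow> nat \<Rightarrow> real" and f :: "nat \<Rightarrow> nat \<Rightarrow> nat"
  assumes normalized: "\<And>p. ((\<lambda>(k, m). (c k m)\<^sup>2) has_sum 1) {(k, m). f k m = p}"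
begin

definition kraus :: "cmat \<Rightarrow> cmat" where
  "kraus A m n = (\<Sum>k. of_real (c k m * c k n) * A (f k m) (f k n))"

text \<open>The fibres of the shift map partition all pairs, and the fibre over \<open>p\<close>
  carries total weight \<open>r p\<close> by normalisation. With \<open>r\<close> the diagonal of a
  state this is trace preservation. Unconditional summation allows the pairs to be regrouped
  afterwards by \<open>m\<close>.\<close>

lemma weighted_has_sum:
  assumes r: "\<And>p. 0 \<le> r p" "r sums s"
  shows "((\<lambda>(k, m). (c k m)\<^sup>2 * r (f k m)) has_sum s) UNIV"
proof -
  define F where "F = (\<lambda>(p::nat, k, m). (c k m)\<^sup>2 * r p)"
  define P where "P = Sigma UNIV (\<lambda>p. {(k, m). f k m = p})"
  have rs: "(r has_sum s) UNIV" using r by (intro sums_nonneg_imp_has_sum)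
  have inner: "((\<lambda>y. F (p, y)) has_sum r p) {(k, m). f k m = p}" for p
    using has_sum_cmult_left[OF normalized[of p], of "r p"] by (simp add: F_def case_prod_unfold)
  have "(\<lambda>x. norm (F x)) summable_on P"
    unfolding P_def Infinite_Sum.abs_summable_on_Sigma_iff
  proof (intro conjI ballI)
    fix p
    have n: "norm (F (p, y)) = F (p, y)" for y using r(1) by (simp add: F_def case_prod_unfold)
    show "(\<lambda>y. norm (F (p, y))) summable_on {(k, m). f k m = p}"
      unfolding n by (rule has_sum_imp_summable[OF inner])
  next
    have n: "norm (F (p, y)) = F (p, y)" for p y using r(1) by (simp add: F_def case_prod_unfold)
    show "(\<lambda>p. norm (infsum (\<lambda>y. norm (F (p, y))) {(k, m). f k m = p})) summable_on UNIV"
      unfolding n infsumI[OF inner] unfolding real_norm_def abs_of_nonneg[OF r(1)]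
      by (rule has_sum_imp_summable[OF rs])
  qed
  then have S: "(F has_sum infsum F P) P"
    by (rule has_sum_infsum[OF abs_summable_summable])
  then have "(r has_sum infsum F P) UNIV"
    unfolding P_def by (rule has_sum_SigmaD) (rule inner)
  then have "(F has_sum s) P" using S rs has_sum_unique by blast
  also have "(F has_sum s) P \<longleftrightarrow> ?thesis"
    by (rule has_sum_reindex_bij_witness[where i = "\<lambda>(k, m). (f k m, k, m)" and j = snd])
       (auto simp: P_def F_def)
  finally show ?thesis .
qed

lemma weighted_sums:
  assumes r: "\<And>p. 0 \<le> r p" "r sums s"
  shows "summable (\<lambda>k. (c k m)\<^sup>2 * r (f k m))"
    "(\<lambda>m. \<Sum>k. (c k m)\<^sup>2 * r (f k m)) sums s"
proof -
  have "((\<lambda>(k, m). (c k m)\<^sup>2 * r (f k m)) has_sum s) UNIV = ((\<lambda>(m, k). (c k m)\<^sup>2 * r (f k m)) has_sum s) (UNIV \<times> UNIV)"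
    by (rule has_sum_reindex_bij_witness[where i = prod.swap and j = prod.swap]) auto
  then have *: "((\<lambda>(m, k). (c k m)\<^sup>2 * r (f k m)) has_sum s) (UNIV \<times> UNIV)"
    using weighted_has_sum[OF r] by blast
  then have on: "(\<lambda>k. (c k m)\<^sup>2 * r (f k m)) summable_on UNIV" for m
    by (rule summable_on_SigmaD1[OF has_sum_imp_summable]) simp
  then show s: "summable (\<lambda>k. (c k m)\<^sup>2 * r (f k m))" for m by (rule summable_on_imp_summable)
  have inner: "((\<lambda>k. (c k m)\<^sup>2 * r (f k m)) has_sum (\<Sum>k. (c k m)\<^sup>2 * r (f k m))) UNIV" for m
    using s[of m] r(1) by (intro sums_nonneg_imp_has_sum summable_sums) auto
  have "((\<lambda>m. \<Sum>k. (c k m)\<^sup>2 * r (f k m)) has_sum s) UNIV"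
    by (rule has_sum_SigmaD[OF *]) (simp add: inner)
  then show "(\<lambda>m. \<Sum>k. (c k m)\<^sup>2 * r (f k m)) sums s" by (rule has_sum_imp_sums)
qed

text \<open>Two majorants \<open>r1\<close>, \<open>r2\<close> are allowed because an off-diagonal
  block \<open>X i j\<close> is controlled by the diagonals of \<open>X i i\<close> and
  \<open>X j j\<close>.\<close>

lemma kraus_summable:
  assumes r1: "\<And>p. 0 \<le> r1 p" "summable r1" and r2: "\<And>p. 0 \<le> r2 p" "summable r2"
    and bound: "\<And>p q s t. cmod (A p q) * (s * t) \<le> s\<^sup>2 * r1 p + t\<^sup>2 * r2 q"
  shows "summable (\<lambda>k. of_real (c k m * c k n) * A (f k m) (f k n))"
proof (rule summable_comparison_test)
  show "\<exists>N. \<forall>k\<ge>N. cmod (of_real (c k m * c k n) * A (f k m) (f k n))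
      \<le> (c k m)\<^sup>2 * r1 (f k m) + (c k n)\<^sup>2 * r2 (f k n)"
  proof (intro exI allI impI)
    fix k
    show "cmod (of_real (c k m * c k n) * A (f k m) (f k n)) \<le> (c k m)\<^sup>2 * r1 (f k m) + (c k n)\<^sup>2 * r2 (f k n)"
      using bound[of "f k m" "f k n" "\<bar>c k m\<bar>" "\<bar>c k n\<bar>"] by (simp add: norm_mult abs_mult mult_ac)
  qed
  show "summable (\<lambda>k. (c k m)\<^sup>2 * r1 (f k m) + (c k n)\<^sup>2 * r2 (f k n))"
    by (intro summable_add weighted_sums(1)[OF r1(1) summable_sums[OF r1(2)]]
        weighted_sums(1)[OF r2(1) summable_sums[OF r2(2)]])
qed

lemma kraus_sums:
  assumes A: "pos_tc A"
  shows "(\<lambda>k. of_real (c k m * c k n) * A (f k m) (f k n)) sums kraus A m n"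
  unfolding kraus_def
  using pos_tcD(2)[OF A]
  by (intro summable_sums kraus_summable[of "\<lambda>p. Re (A p p)" "\<lambda>p. Re (A p p)"]
        pos_form_AMGM pos_tcD(1,3) A) (auto simp: sums_iff)

lemma kraus_pos_tc:
  assumes A: "pos_tc A"
  shows "pos_tc (kraus A)" "rtrace (kraus A) = rtrace A"
proof -
  have "pos_form (\<lambda>m n. \<Sum>k. cnj (of_real (c k m)) * A (f k m) (f k n) * of_real (c k n))"
  proof (intro pos_form_suminf pos_form_pullback pos_tcD(1) A)
    fix m n
    show "summable (\<lambda>k. cnj (complex_of_real (c k m)) * A (f k m) (f k n) * complex_of_real (c k n))"
      using sums_summable[OF kraus_sums[OF A, of m n]] by (simp add: mult_ac)
  qed
  also have "(\<lambda>m n. \<Sum>k. cnj (of_real (c k m)) * A (f k m) (f k n) * of_real (c k n)) = kraus A"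
    by (intro ext) (simp add: kraus_def mult_ac)
  finally have p: "pos_form (kraus A)" .
  have "Re (kraus A m m) = (\<Sum>k. (c k m)\<^sup>2 * Re (A (f k m) (f k m)))" for m
    using sums_unique[OF sums_Re[OF kraus_sums[OF A, of m m]]] by (simp add: power2_eq_square)
  then have "(\<lambda>m. Re (kraus A m m)) sums rtrace A"
    using weighted_sums(2)[of "\<lambda>p. Re (A p p)", OF pos_tcD(3)[OF A] pos_tcD(2)[OF A]] by simp
  then show "pos_tc (kraus A)" "rtrace (kraus A) = rtrace A"
    using p by (auto intro: pos_tcI simp: rtrace_def sums_iff)
qed

lemma kraus_eqI:
  "(\<lambda>k. of_real (c k m * c k n) * A (f k m) (f k n)) sums x \<Longrightarrow> kraus A m n = x"
  unfolding kraus_def by (rule sums_unique[symmetric])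

lemma kraus_sums_combination:
  assumes P: "pos_tc P1" "pos_tc P2" "pos_tc P3" "pos_tc P4"
    and A: "A = (\<lambda>m n. P1 m n - P2 m n + \<i> * (P3 m n - P4 m n))"
  shows "(\<lambda>k. of_real (c k m * c k n) * A (f k m) (f k n)) sums
    (kraus P1 m n - kraus P2 m n + \<i> * (kraus P3 m n - kraus P4 m n))"
proof -
  have "(\<lambda>k. (of_real (c k m * c k n) * P1 (f k m) (f k n) - of_real (c k m * c k n) * P2 (f k m) (f k n))
     + \<i> * (of_real (c k m * c k n) * P3 (f k m) (f k n) - of_real (c k m * c k n) * P4 (f k m) (f k n)))
     sums (kraus P1 m n - kraus P2 m n + \<i> * (kraus P3 m n - kraus P4 m n))"
    by (intro sums_add sums_diff sums_mult kraus_sums P)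
  then show ?thesis
    unfolding A by (simp only: distrib_left right_diff_distrib mult.left_commute[of _ \<i>])
qed

lemma trace_class_kraus_sums:
  assumes "trace_class A"
  shows "(\<lambda>k. of_real (c k m * c k n) * A (f k m) (f k n)) sums kraus A m n"
proof -
  obtain P1 P2 P3 P4 where "pos_tc P1" "pos_tc P2" "pos_tc P3" "pos_tc P4"
    and "A = (\<lambda>m n. P1 m n - P2 m n + \<i> * (P3 m n - P4 m n))"
    using assms unfolding trace_class_def by blast
  from kraus_sums_combination[OF this, of m n] show ?thesis
    using kraus_eqI[of m n A] by simp
qed

lemma kraus_trace_class:
  assumes "trace_class A"
  shows "trace_class (kraus A)" "mat_trace (kraus A) = mat_trace A"
proof -
  obtain P1 P2 P3 P4 where P: "pos_tc P1" "pos_tc P2" "pos_tc P3" "pos_tc P4"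
    and A: "A = (\<lambda>m n. P1 m n - P2 m n + \<i> * (P3 m n - P4 m n))"
    using assms unfolding trace_class_def by blast
  have tr: "mat_trace (\<lambda>m n. Q1 m n - Q2 m n + \<i> * (Q3 m n - Q4 m n))
     = mat_trace Q1 - mat_trace Q2 + \<i> * (mat_trace Q3 - mat_trace Q4)"
    if "pos_tc Q1" "pos_tc Q2" "pos_tc Q3" "pos_tc Q4" for Q1 Q2 Q3 Q4
    unfolding mat_trace_def
    by (intro sums_unique[symmetric] sums_add sums_diff sums_mult summable_sums)
       (use that in \<open>auto simp: pos_tc_def\<close>)
  have "kraus A = (\<lambda>m n. kraus P1 m n - kraus P2 m n + \<i> * (kraus P3 m n - kraus P4 m n))"
    by (intro ext kraus_eqI kraus_sums_combination[OF P A])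
  then show "trace_class (kraus A)" "mat_trace (kraus A) = mat_trace A"
    using kraus_pos_tc[OF P(1)] kraus_pos_tc[OF P(2)] kraus_pos_tc[OF P(3)] kraus_pos_tc[OF P(4)]
      tr[OF P] tr[of "kraus P1" "kraus P2" "kraus P3" "kraus P4"]
    by (auto simp: A trace_class_def pos_tcD(4) P)
qed

end

section \<open>Complete positivity via forms indexed by pairs\<close>

text \<open>A block operator is one form on pairs (block, level), extended by zero beyond
  \<open>k\<close>; the lemmas on positive forms over an arbitrary index type then apply to it
  directly.\<close>

lemma pos_tc_block_iff:
  "pos_tc_block k X \<longleftrightarrow>
     pos_form (\<lambda>(i, m) (j, n). if i < k \<and> j < k then X i j m n else 0) \<and>
     (\<forall>i<k. summable (\<lambda>m. X i i m m))" (is "?L \<longleftrightarrow> pos_form ?X \<and> _")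
proof -
  have form: "(\<Sum>i<k. \<Sum>j<k. \<Sum>m<N. \<Sum>n<N. cnj (v (i, m)) * X i j m n * v (j, n))
     = (\<Sum>x\<in>{..<k} \<times> {..<N}. \<Sum>y\<in>{..<k} \<times> {..<N}. cnj (v x) * ?X x y * v y)"
    for N and v :: "nat \<times> nat \<Rightarrow> complex"
  proof -
    have "(\<Sum>i<k. \<Sum>j<k. \<Sum>m<N. \<Sum>n<N. cnj (v (i, m)) * X i j m n * v (j, n))
       = (\<Sum>i<k. \<Sum>m<N. \<Sum>j<k. \<Sum>n<N. cnj (v (i, m)) * X i j m n * v (j, n))"
      by (intro sum.cong refl sum.swap)
    also have "\<dots> = (\<Sum>x\<in>{..<k} \<times> {..<N}. \<Sum>y\<in>{..<k} \<times> {..<N}. cnj (v x) * ?X x y * v y)"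
    proof -
      have inner: "(\<Sum>j<k. \<Sum>n<N. cnj (v x) * X (fst x) j (snd x) n * v (j, n))
          = (\<Sum>y\<in>{..<k} \<times> {..<N}. cnj (v x) * ?X x y * v y)" if "x \<in> {..<k} \<times> {..<N}" for x
        unfolding sum.cartesian_product using that by (intro sum.cong) auto
      have "(\<Sum>i<k. \<Sum>m<N. \<Sum>j<k. \<Sum>n<N. cnj (v (i, m)) * X i j m n * v (j, n))
        = (\<Sum>(i, m)\<in>{..<k} \<times> {..<N}. \<Sum>j<k. \<Sum>n<N. cnj (v (i, m)) * X i j m n * v (j, n))"
        by (rule sum.cartesian_product)
      also have "\<dots> = (\<Sum>x\<in>{..<k} \<times> {..<N}. \<Sum>y\<in>{..<k} \<times> {..<N}. cnj (v x) * ?X x y * v y)"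
        by (intro sum.cong refl) (auto simp: inner[symmetric] simp del: sum.cartesian_product)
      finally show ?thesis .
    qed
    finally show ?thesis .
  qed
  show ?thesis
  proof
    assume L: ?L
    have "pos_form ?X"
      unfolding pos_form_def
    proof (intro conjI allI impI)
      fix x y :: "nat \<times> nat"
      show "?X x y = cnj (?X y x)"
      proof -
        have "\<forall>i<k. \<forall>j<k. \<forall>m n. X i j m n = cnj (X j i n m)"
          using L unfolding pos_tc_block_def by (elim conjE)
        then have "X (fst x) (fst y) (snd x) (snd y) = cnj (X (fst y) (fst x) (snd y) (snd x))"
          if "fst x < k" "fst y < k" using that by blast
        then show ?thesis by (simp add: case_prod_unfold)
      qed
    next
      fix S :: "(nat \<times> nat) set" and v :: "nat \<times> nat \<Rightarrow> complex"
      assume S: "finite S"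
      define S' where "S' = {x \<in> S. fst x < k}"
      define w where "w = (\<lambda>x. if x \<in> S' then v x else 0)"
      obtain N where N: "snd ` S \<subseteq> {..<N}" using S finite_nat_iff_bounded[of "snd ` S"] by blast
      have sub: "S' \<subseteq> {..<k} \<times> {..<N}" "S' \<subseteq> S" using N by (auto simp: S'_def)
      have "(\<Sum>x\<in>S. \<Sum>y\<in>S. cnj (v x) * ?X x y * v y) = (\<Sum>x\<in>S. \<Sum>y\<in>S. cnj (w x) * ?X x y * w y)"
        by (intro sum.cong refl) (auto simp: w_def S'_def split: prod.split)
      also have "\<dots> = (\<Sum>x\<in>S'. \<Sum>y\<in>S. cnj (w x) * ?X x y * w y)"
        using S sub by (intro sum.mono_neutral_right) (auto simp: w_def)
      also have "\<dots> = (\<Sum>x\<in>S'. \<Sum>y\<in>S'. cnj (w x) * ?X x y * w y)"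
        using S sub by (intro sum.cong refl sum.mono_neutral_right) (auto simp: w_def)
      also have "\<dots> = (\<Sum>x\<in>S'. \<Sum>y\<in>{..<k} \<times> {..<N}. cnj (w x) * ?X x y * w y)"
        using sub by (intro sum.cong refl sum.mono_neutral_left) (auto simp: w_def)
      also have "\<dots> = (\<Sum>x\<in>{..<k} \<times> {..<N}. \<Sum>y\<in>{..<k} \<times> {..<N}. cnj (w x) * ?X x y * w y)"
        using sub by (intro sum.mono_neutral_left) (auto simp: w_def)
      also have "\<dots> = (\<Sum>i<k. \<Sum>j<k. \<Sum>m<N. \<Sum>n<N. cnj (w (i, m)) * X i j m n * w (j, n))"
        by (rule form[symmetric])
      finally have eq: "(\<Sum>x\<in>S. \<Sum>y\<in>S. cnj (v x) * ?X x y * v y) = \<dots>" .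
      show "0 \<le> Re (\<Sum>x\<in>S. \<Sum>y\<in>S. cnj (v x) * ?X x y * v y)"
        unfolding eq using L unfolding pos_tc_block_def
        by (elim conjE allE[of _ N] allE[of _ "\<lambda>i m. w (i, m)"])
    qed
    then show "pos_form ?X \<and> (\<forall>i<k. summable (\<lambda>m. X i i m m))"
      using L unfolding pos_tc_block_def by (elim conjE) (intro conjI)
  next
    assume R: "pos_form ?X \<and> (\<forall>i<k. summable (\<lambda>m. X i i m m))"
    show ?L
      unfolding pos_tc_block_def
    proof (intro conjI allI impI)
      fix i j m n assume "i < k" "j < k"
      then show "X i j m n = cnj (X j i n m)"
        using pos_form_herm[of ?X "(i, m)" "(j, n)"] R by simp
    next
      fix N and v :: "nat \<Rightarrow> nat \<Rightarrow> complex"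
      show "0 \<le> Re (\<Sum>i<k. \<Sum>j<k. \<Sum>m<N. \<Sum>n<N. cnj (v i m) * X i j m n * v j n)"
        using pos_form_nonneg[of ?X "{..<k} \<times> {..<N}" "\<lambda>(i, m). v i m"] R form[where N = N and v = "\<lambda>(i, m). v i m"]
        by (simp only: finite_cartesian_product finite_lessThan prod.case)
    qed (use R in blast)
  qed
qed

context kraus_channel
begin

text \<open>Tensoring the \<open>l\<close>-th Kraus operator with the identity is again a pullback,
  now along the map of pairs that keeps the block index and applies \<open>f l\<close> to the
  level.\<close>

lemma kraus_block:
  assumes X: "pos_tc_block k X"
  shows "pos_tc_block k (\<lambda>i j. kraus (X i j))"
proof -
  define Y where "Y = (\<lambda>(i, m) (j, n). if i < k \<and> j < k then X i j m n else 0)"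
  have Y: "pos_form Y" and s: "\<And>i. i < k \<Longrightarrow> summable (\<lambda>m. X i i m m)"
    using X unfolding pos_tc_block_iff Y_def by auto
  have tc: "pos_tc (X i i)" if "i < k" for i
  proof -
    \<comment> \<open>Compression to the \<open>i\<close>-th diagonal block, with constant weight
      1.\<close>
    have "pos_form (\<lambda>m n. cnj 1 * Y (i, m) (i, n) * 1)"
      by (rule pos_form_pullback[OF Y])
    then have "pos_form (X i i)" using that by (simp add: Y_def)
    then show ?thesis using s[OF that] by (intro pos_tcI summable_Re)
  qed
  have summable: "summable (\<lambda>l. of_real (c l m * c l n) * X i j (f l m) (f l n))"
    if "i < k" "j < k" for i j m n
  proof (rule kraus_summable)
    show "cmod (X i j p q) * (s * t) \<le> s\<^sup>2 * Re (X i i p p) + t\<^sup>2 * Re (X j j q q)" for p q s t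
      using pos_form_AMGM[OF Y, of "(i, p)" "(j, q)" s t] that by (simp add: Y_def)
    show "0 \<le> Re (X i i p p)" "0 \<le> Re (X j j p p)" for p
      using tc[THEN pos_tcD(3)] that by blast+
    show "summable (\<lambda>p. Re (X i i p p))" "summable (\<lambda>p. Re (X j j p p))"
      using s that by (auto intro: summable_Re)
  qed
  have "pos_form (\<lambda>x y. \<Sum>l. cnj (of_real (c l (snd x))) * Y (fst x, f l (snd x)) (fst y, f l (snd y)) * of_real (c l (snd y)))"
  proof (intro pos_form_suminf pos_form_pullback[OF Y])
    fix x y :: "nat \<times> nat"
    show "summable (\<lambda>l. cnj (complex_of_real (c l (snd x))) * Y (fst x, f l (snd x)) (fst y, f l (snd y)) * complex_of_real (c l (snd y)))"
      using summable[of "fst x" "fst y" "snd x" "snd y"]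
      by (cases "fst x < k \<and> fst y < k") (auto simp: Y_def mult_ac)
  qed
  also have "(\<lambda>x y. \<Sum>l. cnj (of_real (c l (snd x))) * Y (fst x, f l (snd x)) (fst y, f l (snd y)) * of_real (c l (snd y)))
    = (\<lambda>(i, m) (j, n). if i < k \<and> j < k then kraus (X i j) m n else 0)"
    by (intro ext) (auto simp: Y_def kraus_def mult_ac split: prod.split)
  finally show ?thesis
    unfolding pos_tc_block_iff using kraus_pos_tc(1)[OF tc] by (auto simp: pos_tc_def)
qed

lemma cptp_kraus: "cptp kraus"
  unfolding cptp_def
proof (intro conjI allI impI)
  fix A B :: cmat and a :: complex
  assume "trace_class A \<and> trace_class B"
  then have "(\<lambda>k. a * (of_real (c k m * c k n) * A (f k m) (f k n)) + of_real (c k m * c k n) * B (f k m) (f k n))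
     sums (a * kraus A m n + kraus B m n)" for m n
    by (intro sums_add sums_mult trace_class_kraus_sums) auto
  then show "kraus (\<lambda>m n. a * A m n + B m n) = (\<lambda>m n. a * kraus A m n + kraus B m n)"
    by (intro ext kraus_eqI) (simp only: distrib_left mult.left_commute[of _ a])
qed (use kraus_trace_class kraus_block in auto)

text \<open>The adjoint map on observables, with \<open>R\<close> Kraus operators and the \<open>N \<times> N\<close> corner of \<open>D\<close>.\<close>

definition dual :: "cmat \<Rightarrow> nat \<Rightarrow> nat \<Rightarrow> cmat" where
  "dual D N R q p = (\<Sum>(k, n, m)\<in>{..<R} \<times> {..<N} \<times> {..<N}.
     if (f k n, f k m) = (p, q) then of_real (c k n * c k m) * D m n else 0)"

lemma sum_dual:
  assumes "finite S" "finite T"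
  shows "(\<Sum>p\<in>S. \<Sum>q\<in>T. G p q * dual D N R q p) =
    (\<Sum>k<R. \<Sum>n<N. \<Sum>m<N. if f k n \<in> S \<and> f k m \<in> T
        then G (f k n) (f k m) * (of_real (c k n * c k m) * D m n) else 0)"
proof -
  have "(\<Sum>p\<in>S. \<Sum>q\<in>T. G p q * dual D N R q p) =
     (\<Sum>x\<in>S \<times> T. G (fst x) (snd x) * (\<Sum>y\<in>{..<R} \<times> {..<N} \<times> {..<N}.
       if (f (fst y) (fst (snd y)), f (fst y) (snd (snd y))) = x
         then of_real (c (fst y) (fst (snd y)) * c (fst y) (snd (snd y))) * D (snd (snd y)) (fst (snd y)) else 0))"
    by (simp add: sum.cartesian_product dual_def case_prod_unfold prod_eq_iff)
  also have "\<dots> = (\<Sum>y\<in>{..<R} \<times> {..<N} \<times> {..<N}.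
     if (f (fst y) (fst (snd y)), f (fst y) (snd (snd y))) \<in> S \<times> T
     then G (f (fst y) (fst (snd y))) (f (fst y) (snd (snd y))) *
        (of_real (c (fst y) (fst (snd y)) * c (fst y) (snd (snd y))) * D (snd (snd y)) (fst (snd y))) else 0)"
    by (subst sum_over_fibres) (use assms in \<open>simp_all cong: if_cong\<close>)
  finally show ?thesis
    by (simp add: sum.cartesian_product case_prod_unfold)
qed

text \<open>The Kraus operators together map \<open>u\<close> isometrically to the family of its
  images; here only finitely many coordinates of that family are kept.\<close>

lemma weighted_finite_le:
  assumes "finite S"
  shows "(\<Sum>k<R. \<Sum>m<N. (cmod (of_real (c k m) * (if f k m \<in> S then u (f k m) else 0)))\<^sup>2)
    \<le> (\<Sum>q\<in>S. (cmod (u q))\<^sup>2)"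
proof -
  define r where "r = (\<lambda>q. if q \<in> S then (cmod (u q))\<^sup>2 else 0)"
  have "r sums (\<Sum>q\<in>S. r q)"
    using assms by (intro sums_finite) (auto simp: r_def)
  then have "r sums (\<Sum>q\<in>S. (cmod (u q))\<^sup>2)" by (simp add: r_def)
  then have *: "((\<lambda>(k, m). (c k m)\<^sup>2 * r (f k m)) has_sum (\<Sum>q\<in>S. (cmod (u q))\<^sup>2)) UNIV"
    by (intro weighted_has_sum) (auto simp: r_def)
  have "(\<Sum>(k, m)\<in>{..<R} \<times> {..<N}. (c k m)\<^sup>2 * r (f k m)) \<le> (\<Sum>q\<in>S. (cmod (u q))\<^sup>2)"
    by (rule has_sum_mono2[OF has_sum_finite *]) (auto simp: r_def)
  also have "(\<Sum>(k, m)\<in>{..<R} \<times> {..<N}. (c k m)\<^sup>2 * r (f k m))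
     = (\<Sum>k<R. \<Sum>m<N. (cmod (of_real (c k m) * (if f k m \<in> S then u (f k m) else 0)))\<^sup>2)"
    unfolding sum.cartesian_product[symmetric]
    by (intro sum.cong refl) (auto simp: r_def norm_mult power_mult_distrib)
  finally show ?thesis .
qed

text \<open>With V the isometry that stacks the Kraus operators, the dual is the adjoint of V times
  copies of \<open>D\<close> times V. Accordingly the contraction bound is used inside each Kraus
  term and Cauchy-Schwarz over the index \<open>k\<close>.\<close>

lemma contraction_dual:
  assumes D: "contraction D"
  shows "contraction (dual D N R)"
  unfolding contraction_def
proof (intro allI impI)
  fix S T :: "nat set" and u v :: "nat \<Rightarrow> complex"
  assume S: "finite S" and T: "finite T"
  define w where "w = (\<lambda>U u k m. of_real (c k m) * (if f k m \<in> U then u (f k m) else (0::complex)))"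
  have le: "L2_set (\<lambda>k. L2_set (\<lambda>m. cmod (w U u k m)) {..<N}) {..<R} \<le> L2_set (\<lambda>m. cmod (u m)) U"
    if "finite U" for U u
    using weighted_finite_le[OF that, where R = R and N = N and u = u]
    unfolding L2_set_def w_def by (simp add: sum_nonneg)
  have "(\<Sum>m\<in>S. \<Sum>n\<in>T. cnj (u m) * dual D N R m n * v n)
     = (\<Sum>n\<in>T. \<Sum>m\<in>S. (v n * cnj (u m)) * dual D N R m n)"
    by (subst sum.swap) (simp add: mult_ac)
  also have "\<dots> = (\<Sum>k<R. \<Sum>n<N. \<Sum>m<N. cnj (w S u k m) * D m n * w T v k n)"
    unfolding sum_dual[OF T S] by (intro sum.cong refl) (auto simp: w_def)
  also have "\<dots> = (\<Sum>k<R. \<Sum>m<N. \<Sum>n<N. cnj (w S u k m) * D m n * w T v k n)"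
    by (intro sum.cong refl sum.swap)
  also have "cmod \<dots> \<le> (\<Sum>k<R. L2_set (\<lambda>m. cmod (w S u k m)) {..<N} * L2_set (\<lambda>m. cmod (w T v k m)) {..<N})"
    by (intro sum_norm_le contractionD D) auto
  also have "\<dots> \<le> (\<Sum>k<R. \<bar>L2_set (\<lambda>m. cmod (w S u k m)) {..<N}\<bar> * \<bar>L2_set (\<lambda>m. cmod (w T v k m)) {..<N}\<bar>)"
    by (simp only: abs_of_nonneg[OF L2_set_nonneg] order_refl)
  also have "\<dots> \<le> L2_set (\<lambda>k. L2_set (\<lambda>m. cmod (w S u k m)) {..<N}) {..<R}
       * L2_set (\<lambda>k. L2_set (\<lambda>m. cmod (w T v k m)) {..<N}) {..<R}"
    by (rule L2_set_mult_ineq)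
  also have "\<dots> \<le> L2_set (\<lambda>m. cmod (u m)) S * L2_set (\<lambda>m. cmod (v m)) T"
    by (intro mult_mono le S T) auto
  finally show "cmod (\<Sum>m\<in>S. \<Sum>n\<in>T. cnj (u m) * dual D N R m n * v n)
     \<le> L2_set (\<lambda>m. cmod (u m)) S * L2_set (\<lambda>n. cmod (v n)) T" .
qed

text \<open>How many Kraus terms approximate the \<open>N\<close> x \<open>N\<close> corner of
  \<open>kraus A\<close> depends on \<open>A\<close>, without an explicit rate. Therefore the
  entrywise limit of the duals is required along every \<open>r\<close> with
  \<open>N \<le> r N\<close>.\<close>

lemma tr_mul_kraus:
  assumes A: "pos_tc A" and D: "contraction D"
    and lim: "\<And>r p q. (\<And>N. N \<le> r N) \<Longrightarrow> (\<lambda>N. dual D N (r N) q p) \<longlonglongrightarrow> E q p"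
  shows "contraction E" "tr_mul (kraus A) D = tr_mul A E"
proof -
  show E: "contraction E"
    by (rule contraction_LIMSEQ[OF contraction_dual[OF D] lim]) auto
  define W where "W = (\<lambda>N R. \<Sum>n<N. \<Sum>m<N. (\<Sum>k<R. of_real (c k n * c k m) * A (f k n) (f k m)) * D m n)"
  have "(\<lambda>R. W N R) \<longlonglongrightarrow> trunc (kraus A) D N N" for N
    unfolding W_def trunc_def
    using kraus_sums[OF A] by (intro tendsto_sum tendsto_mult tendsto_const) (simp add: sums_def)
  \<comment> \<open>A diagonal sequence: for each corner size enough Kraus terms for an error below
    \<open>1 / (N + 1)\<close>.\<close>
  then have "\<exists>R\<ge>N. dist (W N R) (trunc (kraus A) D N N) < 1 / real (Suc N)" for N
    unfolding lim_sequentially by (meson le_cases le_refl divide_pos_pos of_nat_0_less_iff zero_less_Suc zero_less_one)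
  then obtain r where r: "\<And>N. N \<le> r N" "\<And>N. dist (W N (r N)) (trunc (kraus A) D N N) < 1 / real (Suc N)"
    by metis
  have "(\<lambda>N. W N (r N) - trunc (kraus A) D N N) \<longlonglongrightarrow> 0"
    by (rule Lim_null_comparison[OF _ LIMSEQ_Suc[OF lim_1_over_n]])
       (use less_imp_le[OF r(2)] in \<open>simp add: dist_norm\<close>)
  from tendsto_add[OF this tr_mul_tendsto[OF kraus_pos_tc(1)[OF A] D]]
  have 1: "(\<lambda>N. W N (r N)) \<longlonglongrightarrow> tr_mul (kraus A) D" by simp
  \<comment> \<open>A truncated dual has finite support, so its trace against \<open>A\<close> is an
    exact finite corner.\<close>
  have W_trunc: "\<exists>L0. \<forall>L\<ge>L0. W N R = trunc A (dual D N R) L L" for N R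
  proof -
    obtain L0 where L0: "(\<lambda>(k, n). f k n) ` ({..<R} \<times> {..<N}) \<subseteq> {..<L0}"
      using finite_nat_iff_bounded by blast
    have "trunc A (dual D N R) L L = W N R" if "L \<ge> L0" for L
    proof -
      have "f k n < L" if "k < R" "n < N" for k n
        using L0 that \<open>L \<ge> L0\<close> by (force simp: image_subset_iff)
      then have "trunc A (dual D N R) L L = (\<Sum>k<R. \<Sum>n<N. \<Sum>m<N. A (f k n) (f k m) * (of_real (c k n * c k m) * D m n))"
        unfolding trunc_def sum_dual[OF finite_lessThan finite_lessThan] by (intro sum.cong refl) auto
      also have "\<dots> = (\<Sum>n<N. \<Sum>k<R. \<Sum>m<N. A (f k n) (f k m) * (of_real (c k n * c k m) * D m n))"
        by (rule sum.swap)
      also have "\<dots> = (\<Sum>n<N. \<Sum>m<N. \<Sum>k<R. A (f k n) (f k m) * (of_real (c k n * c k m) * D m n))"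
        by (intro sum.cong refl sum.swap)
      also have "\<dots> = W N R"
        unfolding W_def by (intro sum.cong refl) (simp add: sum_distrib_left mult_ac)
      finally show ?thesis .
    qed
    then show ?thesis by metis
  qed
  have W_err: "cmod (W N R - trunc A (dual D N R) K K) \<le> trunc_err A K" for N R K
  proof -
    obtain L0 where "\<And>L. L \<ge> L0 \<Longrightarrow> W N R = trunc A (dual D N R) L L" using W_trunc by blast
    then have "W N R = trunc A (dual D N R) (max L0 K) (max L0 K)" by simp
    then show ?thesis using trunc_diff[OF A contraction_dual[OF D], of K "max L0 K" "max L0 K"] by simp
  qed
  \<comment> \<open>For fixed \<open>K\<close> the limit in \<open>N\<close> is taken first; the
    error bound is uniform in \<open>N\<close>, and \<open>K\<close> tends to infinity only
    afterwards.\<close>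
  have 2: "cmod (tr_mul (kraus A) D - trunc A E K K) \<le> trunc_err A K" for K
  proof (rule LIMSEQ_le_const2)
    show "(\<lambda>N. cmod (W N (r N) - trunc A (dual D N (r N)) K K)) \<longlonglongrightarrow> cmod (tr_mul (kraus A) D - trunc A E K K)"
      unfolding trunc_def by (intro tendsto_intros 1 lim r)
  qed (use W_err in blast)
  have "(\<lambda>K. trunc A E K K - tr_mul (kraus A) D) \<longlonglongrightarrow> 0"
    by (rule Lim_null_comparison[OF _ trunc_err_tendsto[OF A]])
       (use 2 in \<open>simp add: norm_minus_commute\<close>)
  then have "(\<lambda>K. trunc A E K K) \<longlonglongrightarrow> tr_mul (kraus A) D" by (simp add: LIM_zero_iff)
  then show "tr_mul (kraus A) D = tr_mul A E"
    using LIMSEQ_unique tr_mul_tendsto[OF A E] by blast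
qed

end


section \<open>Displacement operators\<close>

text \<open>The matrix of \<open>exp (\<alpha> * a\<^sup>\<dagger>)\<close> in the number basis.\<close>

definition exp_raise :: "complex \<Rightarrow> cmat" where
  "exp_raise \<alpha> m k = (if k \<le> m then of_real (sqrt (fact m / fact k) / fact (m - k)) * \<alpha> ^ (m - k) else 0)"

text \<open>Normal ordering: the lowering exponential with parameter \<open>- cnj \<xi>\<close> is
  the adjoint of the raising exponential with parameter \<open>- \<xi>\<close>.\<close>

lemma disp_eq_exp_raise:
  "disp \<xi> m n = of_real (exp (- ((cmod \<xi>)\<^sup>2 / 2))) *
     (\<Sum>k\<le>min m n. exp_raise \<xi> m k * cnj (exp_raise (- \<xi>) n k))"
proof -
  have "complex_of_real (sqrt (fact m * fact n) / (fact k * fact (m - k) * fact (n - k))) * \<xi> ^ (m - k) * (- cnj \<xi>) ^ (n - k)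
      = exp_raise \<xi> m k * cnj (exp_raise (- \<xi>) n k)" if "k \<le> min m n" for k
  proof -
    have "sqrt (fact m * fact n) / (fact k * fact (m - k) * fact (n - k))
      = (sqrt (fact m / fact k) / fact (m - k)) * (sqrt (fact n / fact k) / fact (n - k))"
      by (simp add: real_sqrt_divide real_sqrt_mult)
    then show ?thesis using that by (simp add: exp_raise_def mult_ac)
  qed
  then show ?thesis
    unfolding disp_def by (simp flip: exp_of_real)
qed

text \<open>The group law of the raising exponentials. The matrices are lower triangular, so the
  products are finite, and with \<open>\<beta> = - \<alpha>\<close> it provides inverses.\<close>

lemma exp_raise_mult:
  "(\<Sum>k\<le>n. exp_raise \<alpha> n k * exp_raise \<beta> k l) = exp_raise (\<alpha> + \<beta>) n l"
proof (cases "l \<le> n")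
  case False
  then show ?thesis by (auto simp: exp_raise_def intro!: sum.neutral)
next
  case True
  define d where "d = n - l"
  have n: "n = l + d" using True by (simp add: d_def)
  have "(\<Sum>k\<le>n. exp_raise \<alpha> n k * exp_raise \<beta> k l) = (\<Sum>k\<in>{l..n}. exp_raise \<alpha> n k * exp_raise \<beta> k l)"
    by (rule sum.mono_neutral_right) (auto simp: exp_raise_def)
  also have "\<dots> = (\<Sum>i\<le>d. exp_raise \<alpha> n (l + i) * exp_raise \<beta> (l + i) l)"
    by (rule sum.reindex_bij_witness[where i = "\<lambda>i. l + i" and j = "\<lambda>k. k - l"]) (auto simp: n)
  also have "\<dots> = (\<Sum>i\<le>d. of_real (sqrt (fact n / fact l) / fact d) * (of_nat (d choose i) * \<beta> ^ i * \<alpha> ^ (d - i)))"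
  proof (intro sum.cong refl)
    fix i assume "i \<in> {..d}"
    then have i: "i \<le> d" by simp
    have "sqrt (fact n / fact (l + i)) * sqrt (fact (l + i) / fact l) = sqrt (fact n / fact l :: real)"
      by (simp add: real_sqrt_divide)
    then have "(sqrt (fact n / fact (l + i)) / fact (n - (l + i))) * (sqrt (fact (l + i) / fact l) / fact i)
       = sqrt (fact n / fact l) / fact d * real (d choose i)"
      using i by (simp add: binomial_fact n field_simps)
    then have "complex_of_real ((sqrt (fact n / fact (l + i)) / fact (n - (l + i))) * (sqrt (fact (l + i) / fact l) / fact i))
       = of_real (sqrt (fact n / fact l) / fact d) * of_nat (d choose i)"
      by (simp only: of_real_mult of_real_of_nat_eq)
    moreover have "exp_raise \<alpha> n (l + i) * exp_raise \<beta> (l + i) l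
       = complex_of_real ((sqrt (fact n / fact (l + i)) / fact (n - (l + i))) * (sqrt (fact (l + i) / fact l) / fact i))
         * (\<beta> ^ i * \<alpha> ^ (d - i))"
      using i by (simp add: exp_raise_def n mult_ac)
    ultimately show "exp_raise \<alpha> n (l + i) * exp_raise \<beta> (l + i) l =
        of_real (sqrt (fact n / fact l) / fact d) * (of_nat (d choose i) * \<beta> ^ i * \<alpha> ^ (d - i))"
      by (simp only: mult.assoc)
  qed
  also have "\<dots> = exp_raise (\<alpha> + \<beta>) n l"
    unfolding sum_distrib_left[symmetric] binomial_ring[symmetric]
    using True by (simp add: exp_raise_def d_def add.commute)
  finally show ?thesis .
qed

text \<open>Vandermonde's identity for choosing \<open>n\<close> out of \<open>m\<close> and
  \<open>j - m\<close> elements, divided by factorials; the guard marks the terms where the second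
  binomial is nonzero.\<close>

lemma fact_vandermonde:
  assumes "m \<le> j" "n \<le> j"
  shows "(\<Sum>k\<le>min m n. if m + n - k \<le> j
      then 1 / (fact k * fact (m - k) * fact (n - k) * fact (j - (m + n - k))) else 0)
    = (fact j / (fact m * fact n * fact (j - m) * fact (j - n)) :: real)"
proof -
  have "(\<Sum>k\<le>min m n. if m + n - k \<le> j
      then 1 / (fact k * fact (m - k) * fact (n - k) * fact (j - (m + n - k))) else 0)
    = (\<Sum>k\<le>min m n. real ((m choose k) * (j - m choose (n - k))) / (fact m * fact (j - m)))"
  proof (intro sum.cong refl)
    fix k assume k: "k \<in> {..min m n}"
    show "(if m + n - k \<le> j
      then 1 / (fact k * fact (m - k) * fact (n - k) * fact (j - (m + n - k))) else 0)
      = real ((m choose k) * (j - m choose (n - k))) / (fact m * fact (j - m))"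
    proof (cases "m + n - k \<le> j")
      case True
      then have "n - k \<le> j - m" "j - m - (n - k) = j - (m + n - k)" using k by auto
      then show ?thesis using True k by (simp add: binomial_fact)
    next
      case False
      then have "j - m < n - k" using k assms by auto
      then show ?thesis using False by (simp add: binomial_eq_0)
    qed
  qed
  also have "\<dots> = (\<Sum>k\<le>n. real ((m choose k) * (j - m choose (n - k))) / (fact m * fact (j - m)))"
    by (rule sum.mono_neutral_left) (auto simp: binomial_eq_0)
  also have "\<dots> = real (\<Sum>k\<le>n. (m choose k) * (j - m choose (n - k))) / (fact m * fact (j - m))"
    by (simp add: sum_divide_distrib)
  also have "(\<Sum>k\<le>n. (m choose k) * (j - m choose (n - k))) = j choose n"
    using vandermonde[of m "j - m" n] assms by simp
  finally show ?thesis using assms by (simp add: binomial_fact)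
qed

text \<open>The commutation relation \<open>exp (cnj \<alpha> * a) exp (\<beta> * a\<^sup>\<dagger>) = exp (cnj \<alpha> * \<beta>) exp (\<beta> * a\<^sup>\<dagger>) exp (cnj \<alpha> * a)\<close>
  in matrix form; comparing powers of \<open>cnj \<alpha>\<close> and \<open>\<beta>\<close> reduces it to Vandermonde's identity.\<close>

lemma exp_raise_antinormal:
  "(\<lambda>j. cnj (exp_raise \<alpha> j m) * exp_raise \<beta> j n) sums
     (exp (cnj \<alpha> * \<beta>) * (\<Sum>k\<le>min m n. exp_raise \<beta> m k * cnj (exp_raise \<alpha> n k)))"
proof -
  define x where "x = cnj \<alpha>"
  \<comment> \<open>The exponential series, delayed by \<open>m + n - k\<close>, so that for every
    \<open>k\<close> the \<open>j\<close>-th term ends up with the same monomial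
    \<open>x ^ (j - m) * \<beta> ^ (j - n)\<close>.\<close>
  define E where "E = (\<lambda>k j. if m + n - k \<le> j then (x * \<beta>) ^ (j - (m + n - k)) / fact (j - (m + n - k)) else 0)"
  have E: "E k sums exp (x * \<beta>)" for k
  proof -
    have "(\<lambda>i. (x * \<beta>) ^ i / fact i) sums exp (x * \<beta>)"
      using exp_converges[of "x * \<beta>"] by (simp add: scaleR_conv_of_real field_simps)
    then have "(\<lambda>i. E k (i + (m + n - k))) sums exp (x * \<beta>)"
      by (simp add: E_def)
    then show ?thesis by (subst (asm) sums_zero_iff_shift) (auto simp: E_def)
  qed
  have "(\<lambda>j. \<Sum>k\<le>min m n. exp_raise \<beta> m k * cnj (exp_raise \<alpha> n k) * E k j) sums
     (\<Sum>k\<le>min m n. exp_raise \<beta> m k * cnj (exp_raise \<alpha> n k) * exp (x * \<beta>))"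
    by (intro sums_sum sums_mult E)
  moreover have "(\<Sum>k\<le>min m n. exp_raise \<beta> m k * cnj (exp_raise \<alpha> n k) * E k j)
     = cnj (exp_raise \<alpha> j m) * exp_raise \<beta> j n" for j
  proof (cases "m \<le> j \<and> n \<le> j")
    case False
    then have "E k j = 0" if "k \<le> min m n" for k
      using that by (auto simp: E_def)
    then show ?thesis using False by (auto simp: exp_raise_def intro!: sum.neutral)
  next
    case True
    define r where "r = (\<lambda>k. if m + n - k \<le> j
      then 1 / (fact k * fact (m - k) * fact (n - k) * fact (j - (m + n - k))) else (0::real))"
    have "exp_raise \<beta> m k * cnj (exp_raise \<alpha> n k) * E k j
       = of_real (sqrt (fact m) * sqrt (fact n) * r k) * (x ^ (j - m) * \<beta> ^ (j - n))" if "k \<le> min m n" for k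
    proof (cases "m + n - k \<le> j")
      case True
      have "x ^ (j - m) = x ^ (n - k) * x ^ (j - (m + n - k))"
        "\<beta> ^ (j - n) = \<beta> ^ (m - k) * \<beta> ^ (j - (m + n - k))"
        using True that by (auto simp flip: power_add)
      moreover have "sqrt (fact m) * sqrt (fact n) * r k
         = (sqrt (fact m / fact k) / fact (m - k)) * (sqrt (fact n / fact k) / fact (n - k)) * (1 / fact (j - (m + n - k)))"
        using True by (simp add: r_def real_sqrt_divide)
      ultimately show ?thesis
        using True that by (simp add: exp_raise_def E_def x_def power_mult_distrib)
    qed (simp add: E_def r_def)
    then have "(\<Sum>k\<le>min m n. exp_raise \<beta> m k * cnj (exp_raise \<alpha> n k) * E k j)
      = of_real (sqrt (fact m) * sqrt (fact n) * (\<Sum>k\<le>min m n. r k)) * (x ^ (j - m) * \<beta> ^ (j - n))"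
      by (simp add: sum_distrib_left sum_distrib_right)
    also have "(\<Sum>k\<le>min m n. r k) = fact j / (fact m * fact n * fact (j - m) * fact (j - n))"
      unfolding r_def using True by (intro fact_vandermonde) auto
    also have "sqrt (fact m) * sqrt (fact n) * (fact j / (fact m * fact n * fact (j - m) * fact (j - n)))
        = (sqrt (fact j / fact m) / fact (j - m)) * (sqrt (fact j / fact n) / fact (j - n) :: real)"
    proof -
      have s: "(fact i :: real) = sqrt (fact i) * sqrt (fact i)" for i by simp
      have "sqrt (fact m) * sqrt (fact n) * (sqrt (fact j) * sqrt (fact j) /
          ((sqrt (fact m) * sqrt (fact m)) * (sqrt (fact n) * sqrt (fact n)) * fact (j - m) * fact (j - n)))
        = (sqrt (fact j / fact m) / fact (j - m)) * (sqrt (fact j / fact n) / fact (j - n) :: real)"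
        unfolding real_sqrt_divide by (simp del: real_sqrt_mult_self add: field_simps)
      then show ?thesis by simp
    qed
    finally show ?thesis using True by (simp add: exp_raise_def x_def mult_ac)
  qed
  ultimately show ?thesis by (simp add: x_def sum_distrib_left mult_ac)
qed

text \<open>Reversing the order of the two exponentials costs
  \<open>exp (- (cmod \<xi>)\<^sup>2)\<close>, the square of the prefactor in \<open>disp\<close>;
  one of the two copies is absorbed in \<open>disp\<close>.\<close>

lemma disp_antinormal:
  "(\<lambda>j. cnj (exp_raise (- \<xi>) j m) * exp_raise \<xi> j n) sums (of_real (exp (- ((cmod \<xi>)\<^sup>2 / 2))) * disp \<xi> m n)"
proof -
  have "cnj (- \<xi>) * \<xi> = of_real (- ((cmod \<xi>)\<^sup>2))"
    by (simp add: complex_norm_square[unfolded of_real_power] mult.commute)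
  then have "exp (cnj (- \<xi>) * \<xi>) = of_real (exp (- ((cmod \<xi>)\<^sup>2)))" by (simp only: exp_of_real)
  also have "- ((cmod \<xi>)\<^sup>2) = - ((cmod \<xi>)\<^sup>2 / 2) + - ((cmod \<xi>)\<^sup>2 / 2)" by simp
  finally show ?thesis
    using exp_raise_antinormal[of "- \<xi>" m \<xi> n] unfolding disp_eq_exp_raise exp_add by (simp add: mult.assoc)
qed

text \<open>Write D = e X U' with X the raising matrix for \<open>\<xi>\<close> and U' the adjoint
  of that for \<open>- \<xi>\<close>. The inner product of X with itself is reordered by the
  commutation relation, its exponential cancels against e squared, and U X = 1 removes the rest.
  Triangularity of U keeps all sums finite but the one over \<open>m\<close>.\<close>

lemma disp_isometry:
  "(\<lambda>m. cnj (disp \<xi> m n) * disp \<xi> m n') sums (if n = n' then 1 else 0)"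
proof -
  define e where "e = complex_of_real (exp (- ((cmod \<xi>)\<^sup>2 / 2)))"
  define U where "U = (\<lambda>n k. exp_raise (- \<xi>) n k)"
  have D: "disp \<xi> m n = e * (\<Sum>k\<le>n. exp_raise \<xi> m k * cnj (U n k))" for m n
    unfolding disp_eq_exp_raise e_def U_def
    by (intro arg_cong[where f = "(*) _"] sum.mono_neutral_left) (auto simp: exp_raise_def)
  have one: "e * cnj e * exp (cnj \<xi> * \<xi>) = 1"
  proof -
    have "cnj \<xi> * \<xi> = of_real ((cmod \<xi>)\<^sup>2)" by (simp add: complex_norm_square[unfolded of_real_power] mult.commute)
    then have "exp (cnj \<xi> * \<xi>) = of_real (exp ((cmod \<xi>)\<^sup>2))" by (simp only: exp_of_real)
    then have "e * cnj e * exp (cnj \<xi> * \<xi>) = of_real (exp (- ((cmod \<xi>)\<^sup>2 / 2)) * exp (- ((cmod \<xi>)\<^sup>2 / 2)) * exp ((cmod \<xi>)\<^sup>2))"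
      by (simp add: e_def)
    also have "exp (- ((cmod \<xi>)\<^sup>2 / 2)) * exp (- ((cmod \<xi>)\<^sup>2 / 2)) * exp ((cmod \<xi>)\<^sup>2) = 1"
      by (simp flip: exp_add)
    finally show ?thesis by simp
  qed
  have UE: "(\<Sum>k\<le>n. U n k * exp_raise \<xi> k l) = (if n = l then 1 else 0)" for n l
    unfolding U_def exp_raise_mult by (auto simp: exp_raise_def)
  have "(\<lambda>m. e * cnj e * (\<Sum>k\<le>n. \<Sum>k'\<le>n'. U n k * cnj (U n' k') * (cnj (exp_raise \<xi> m k) * exp_raise \<xi> m k')))
     sums (e * cnj e * (\<Sum>k\<le>n. \<Sum>k'\<le>n'. U n k * cnj (U n' k') *
        (exp (cnj \<xi> * \<xi>) * (\<Sum>l\<le>min k k'. exp_raise \<xi> k l * cnj (exp_raise \<xi> k' l)))))"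
    by (intro sums_mult sums_sum exp_raise_antinormal)
  moreover have "(\<Sum>k\<le>n. \<Sum>k'\<le>n'. U n k * cnj (U n' k') *
        (exp (cnj \<xi> * \<xi>) * (\<Sum>l\<le>min k k'. exp_raise \<xi> k l * cnj (exp_raise \<xi> k' l))))
      = exp (cnj \<xi> * \<xi>) * (if n = n' then 1 else 0)"
  proof -
    have "(\<Sum>k\<le>n. \<Sum>k'\<le>n'. U n k * cnj (U n' k') *
        (exp (cnj \<xi> * \<xi>) * (\<Sum>l\<le>min k k'. exp_raise \<xi> k l * cnj (exp_raise \<xi> k' l))))
      = (\<Sum>k\<le>n. \<Sum>k'\<le>n'. U n k * cnj (U n' k') *
        (exp (cnj \<xi> * \<xi>) * (\<Sum>l\<le>n. exp_raise \<xi> k l * cnj (exp_raise \<xi> k' l))))"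
      by (intro sum.cong refl arg_cong[where f = "(*) _"] sum.mono_neutral_left) (auto simp: exp_raise_def)
    also have "\<dots> = (\<Sum>k\<le>n. \<Sum>k'\<le>n'. \<Sum>l\<le>n. exp (cnj \<xi> * \<xi>) * (U n k * exp_raise \<xi> k l * cnj (U n' k' * exp_raise \<xi> k' l)))"
      by (simp add: sum_distrib_left mult_ac)
    also have "\<dots> = (\<Sum>k\<le>n. \<Sum>l\<le>n. \<Sum>k'\<le>n'. exp (cnj \<xi> * \<xi>) * (U n k * exp_raise \<xi> k l * cnj (U n' k' * exp_raise \<xi> k' l)))"
      by (intro sum.cong refl sum.swap)
    also have "\<dots> = (\<Sum>l\<le>n. \<Sum>k\<le>n. \<Sum>k'\<le>n'. exp (cnj \<xi> * \<xi>) * (U n k * exp_raise \<xi> k l * cnj (U n' k' * exp_raise \<xi> k' l)))"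
      by (rule sum.swap)
    also have "\<dots> = (\<Sum>l\<le>n. exp (cnj \<xi> * \<xi>) * ((\<Sum>k\<le>n. U n k * exp_raise \<xi> k l) * cnj (\<Sum>k'\<le>n'. U n' k' * exp_raise \<xi> k' l)))"
      by (simp only: sum_product cnj_sum) (simp only: sum_distrib_left)
    also have "\<dots> = (\<Sum>l\<le>n. if l = n then exp (cnj \<xi> * \<xi>) * (if n = n' then 1 else 0) else 0)"
      unfolding UE by (intro sum.cong) auto
    also have "\<dots> = exp (cnj \<xi> * \<xi>) * (if n = n' then 1 else 0)" by (simp add: sum.delta)
    finally show ?thesis .
  qed
  moreover have "e * cnj e * (\<Sum>k\<le>n. \<Sum>k'\<le>n'. U n k * cnj (U n' k') * (cnj (exp_raise \<xi> m k) * exp_raise \<xi> m k'))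
     = cnj (disp \<xi> m n) * disp \<xi> m n'" for m
  proof -
    have "(\<Sum>k\<le>n. \<Sum>k'\<le>n'. U n k * cnj (U n' k') * (cnj (exp_raise \<xi> m k) * exp_raise \<xi> m k'))
      = (\<Sum>k\<le>n. cnj (exp_raise \<xi> m k) * U n k) * (\<Sum>k'\<le>n'. exp_raise \<xi> m k' * cnj (U n' k'))"
      unfolding sum_product by (intro sum.cong refl) (simp add: mult_ac)
    then show ?thesis unfolding D by simp
  qed
  ultimately show ?thesis using one by (simp add: mult.assoc[symmetric])
qed

text \<open>Orthonormal columns preserve the norm of a finitely supported vector; restriction to
  \<open>S\<close> and Cauchy-Schwarz with \<open>u\<close> follow.\<close>

lemma contraction_disp: "contraction (disp \<xi>)"
  unfolding contraction_def
proof (intro allI impI)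
  fix S T :: "nat set" and u v :: "nat \<Rightarrow> complex"
  assume S: "finite S" and T: "finite T"
  define w where "w = (\<lambda>m. \<Sum>n\<in>T. disp \<xi> m n * v n)"
  have "(\<lambda>m. \<Sum>n\<in>T. \<Sum>n'\<in>T. cnj (v n) * v n' * (cnj (disp \<xi> m n) * disp \<xi> m n')) sums
     (\<Sum>n\<in>T. \<Sum>n'\<in>T. cnj (v n) * v n' * (if n = n' then 1 else 0))"
    by (intro sums_sum sums_mult disp_isometry)
  moreover have "(\<Sum>n\<in>T. \<Sum>n'\<in>T. cnj (v n) * v n' * (cnj (disp \<xi> m n) * disp \<xi> m n')) = of_real ((cmod (w m))\<^sup>2)" for m
  proof -
    have "of_real ((cmod (w m))\<^sup>2) = cnj (w m) * w m"
      unfolding complex_norm_square by (rule mult.commute)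
    also have "\<dots> = (\<Sum>n\<in>T. \<Sum>n'\<in>T. cnj (disp \<xi> m n * v n) * (disp \<xi> m n' * v n'))"
      unfolding w_def cnj_sum by (rule sum_product)
    finally show ?thesis by (simp add: mult_ac)
  qed
  moreover have "(\<Sum>n\<in>T. \<Sum>n'\<in>T. cnj (v n) * v n' * (if n = n' then 1 else 0)) = of_real (\<Sum>n\<in>T. (cmod (v n))\<^sup>2)"
  proof -
    have "(\<Sum>n\<in>T. \<Sum>n'\<in>T. cnj (v n) * v n' * (if n = n' then 1 else 0)) = (\<Sum>n\<in>T. cnj (v n) * v n)"
      using T by (intro sum.cong refl) (simp add: if_distrib[of "(*) _"] cong: if_cong)
    also have "\<dots> = of_real (\<Sum>n\<in>T. (cmod (v n))\<^sup>2)"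
      unfolding of_real_sum complex_norm_square by (intro sum.cong refl mult.commute)
    finally show ?thesis .
  qed
  ultimately have "(\<lambda>m. (cmod (w m))\<^sup>2) sums (\<Sum>n\<in>T. (cmod (v n))\<^sup>2)"
    by (simp only: sums_of_real_iff)
  then have "(\<Sum>m\<in>S. (cmod (w m))\<^sup>2) \<le> (\<Sum>n\<in>T. (cmod (v n))\<^sup>2)"
    using S sum_le_suminf[of "\<lambda>m. (cmod (w m))\<^sup>2" S] by (simp add: sums_iff)
  then have wv: "L2_set (\<lambda>m. cmod (w m)) S \<le> L2_set (\<lambda>n. cmod (v n)) T"
    unfolding L2_set_def by simp
  have "(\<Sum>m\<in>S. \<Sum>n\<in>T. cnj (u m) * disp \<xi> m n * v n) = (\<Sum>m\<in>S. cnj (u m) * w m)"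
    by (simp add: w_def sum_distrib_left mult_ac)
  also have "cmod \<dots> \<le> (\<Sum>m\<in>S. \<bar>cmod (u m)\<bar> * \<bar>cmod (w m)\<bar>)"
    by (rule sum_norm_le) (simp add: norm_mult)
  also have "\<dots> \<le> L2_set (\<lambda>m. cmod (u m)) S * L2_set (\<lambda>m. cmod (w m)) S"
    by (rule L2_set_mult_ineq)
  also have "\<dots> \<le> L2_set (\<lambda>m. cmod (u m)) S * L2_set (\<lambda>n. cmod (v n)) T"
    by (intro mult_left_mono wv) auto
  finally show "cmod (\<Sum>m\<in>S. \<Sum>n\<in>T. cnj (u m) * disp \<xi> m n * v n)
       \<le> L2_set (\<lambda>m. cmod (u m)) S * L2_set (\<lambda>n. cmod (v n)) T" .
qed


section \<open>Attenuator and amplifier\<close>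

lemma of_real_binomial_sum: "(\<Sum>k\<le>l. real (l choose k) * (1 - y) ^ k * y ^ (l - k)) = 1"
  using binomial_ring[of "1 - y" y l] by simp

text \<open>The binomial series for \<open>(1 - y)\<close> to the power
  \<open>- (p + 1)\<close>.\<close>

lemma negative_binomial_sums:
  fixes y :: real
  assumes "0 \<le> y" "y < 1"
  shows "(\<lambda>k. real (p + k choose k) * y ^ k * (1 - y) ^ Suc p) sums 1"
proof -
  have "(\<lambda>k. ((- real (Suc p)) gchoose k) * (- y) ^ k) sums (1 + - y) powr (- real (Suc p))"
    using assms by (intro gen_binomial_real) auto
  moreover have "((- real (Suc p)) gchoose k) * (- y) ^ k = real (p + k choose k) * y ^ k" for k
  proof -
    have "((- real (Suc p)) gchoose k) = (- 1) ^ k * real (p + k choose k)"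
      unfolding gbinomial_minus binomial_gbinomial by (simp add: add_ac)
    moreover have "(- 1) ^ k * (- y) ^ k = y ^ k" by (simp flip: power_mult_distrib)
    ultimately show ?thesis by (simp add: mult_ac)
  qed
  ultimately have "(\<lambda>k. real (p + k choose k) * y ^ k) sums (1 - y) powr (- real (Suc p))" by simp
  from sums_mult2[OF this, of "(1 - y) ^ Suc p"]
  have "(\<lambda>k. real (p + k choose k) * y ^ k * (1 - y) ^ Suc p) sums ((1 - y) powr (- real (Suc p)) * (1 - y) ^ Suc p)" .
  also have "(1 - y) powr (- real (Suc p)) * (1 - y) ^ Suc p = 1"
  proof -
    have "(1 - y) powr real (Suc p) = (1 - y) ^ Suc p" using assms by (intro powr_realpow) simp
    moreover have "(1 - y) ^ Suc p \<noteq> 0" using assms by simp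
    ultimately show ?thesis unfolding powr_minus by (metis left_inverse)
  qed
  finally show ?thesis .
qed

lemma power_square_commute: "(x ^ m)\<^sup>2 = (x\<^sup>2) ^ m" for x :: real
  by (simp add: mult.commute flip: power_mult)

text \<open>For a shift each Kraus operator contributes at most one nonzero entry of
  \<open>D\<close>. Index pairs with vanishing coefficient may be dropped, which is needed where
  truncated subtraction sends several levels to 0.\<close>

lemma (in kraus_channel) dual_eq_sum:
  assumes K: "finite K"
    and sub: "\<And>k. k \<in> K \<Longrightarrow> k < R \<and> n k < N \<and> m k < N \<and> f k (n k) = p \<and> f k (m k) = q"
    and zero: "\<And>k n' m'. k < R \<Longrightarrow> n' < N \<Longrightarrow> m' < N \<Longrightarrow> f k n' = p \<Longrightarrow> f k m' = q \<Longrightarrow> c k n' * c k m' \<noteq> 0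
       \<Longrightarrow> k \<in> K \<and> n' = n k \<and> m' = m k"
  shows "dual D N R q p = (\<Sum>k\<in>K. of_real (c k (n k) * c k (m k)) * D (m k) (n k))"
proof -
  define g where "g = (\<lambda>k. (k, n k, m k))"
  define h where "h = (\<lambda>(k, n, m). if (f k n, f k m) = (p, q) then of_real (c k n * c k m) * D m n else 0)"
  have "dual D N R q p = (\<Sum>y\<in>{..<R} \<times> {..<N} \<times> {..<N}. h y)"
    unfolding dual_def h_def ..
  also have "\<dots> = (\<Sum>y\<in>g ` K. h y)"
  proof (intro sum.mono_neutral_right ballI)
    show "g ` K \<subseteq> {..<R} \<times> {..<N} \<times> {..<N}" using sub by (auto simp: g_def)
    fix y assume y: "y \<in> {..<R} \<times> {..<N} \<times> {..<N} - g ` K"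
    obtain k n' m' where [simp]: "y = (k, n', m')" by (cases y) auto
    show "h y = 0"
    proof (rule ccontr)
      assume "h y \<noteq> 0"
      then have "f k n' = p" "f k m' = q" "c k n' * c k m' \<noteq> 0" by (auto simp: h_def split: if_splits)
      then have "y \<in> g ` K" using zero[of k n' m'] y by (auto simp: g_def)
      then show False using y by blast
    qed
  qed simp
  also have "\<dots> = (\<Sum>k\<in>K. h (g k))"
    by (subst sum.reindex) (auto simp: g_def inj_on_def)
  finally show ?thesis using sub by (simp add: h_def g_def)
qed

section \<open>The attenuator and normal ordering\<close>

text \<open>The amplitude for losing \<open>k\<close> quanta in a beam splitter of transmissivity
  \<open>a\<^sup>2\<close>. Since \<open>a ^ m\<close> keeps the sign of \<open>a\<close>, negative
  \<open>a\<close> is included; \<open>a = -1\<close> is the parity operator.\<close>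

definition att_coeff :: "real \<Rightarrow> nat \<Rightarrow> nat \<Rightarrow> real" where
  "att_coeff a k m = sqrt (real (m + k choose k)) * a ^ m * sqrt (1 - a\<^sup>2) ^ k"

lemma kraus_channel_att:
  assumes a: "\<bar>a\<bar> \<le> 1"
  shows "kraus_channel (att_coeff a) (\<lambda>k m. m + k)"
proof
  fix p :: nat
  have y: "0 \<le> 1 - a\<^sup>2" using a by (simp add: abs_square_le_1)
  have "(\<Sum>k\<le>p. (att_coeff a k (p - k))\<^sup>2) = (\<Sum>k\<le>p. real (p choose k) * (1 - a\<^sup>2) ^ k * (a\<^sup>2) ^ (p - k))"
    using y by (intro sum.cong refl) (simp add: att_coeff_def power_mult_distrib power_square_commute)
  then have "((\<lambda>k. (att_coeff a k (p - k))\<^sup>2) has_sum 1) {..p}"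
    using of_real_binomial_sum[where l = p and y = "a\<^sup>2"] by (intro has_sum_finiteI) auto
  also have "?this \<longleftrightarrow> ((\<lambda>(k, m). (att_coeff a k m)\<^sup>2) has_sum 1) {(k, m). m + k = p}"
    by (rule has_sum_reindex_bij_witness[where i = fst and j = "\<lambda>k. (k, p - k)"]) auto
  finally show "((\<lambda>(k, m). (att_coeff a k m)\<^sup>2) has_sum 1) {(k, m). m + k = p}" .
qed

text \<open>Commuting a Kraus operator past a raising exponential rescales its parameter by
  \<open>a\<close>. The remaining coefficient depends on \<open>k\<close> and \<open>l\<close>
  alone, so in a product of two such factors it squares to a binomial weight.\<close>

lemma att_coeff_exp_raise:
  assumes "k \<le> l" "l \<le> p"
  shows "of_real (att_coeff a k (p - k)) * exp_raise \<xi> (p - k) (l - k)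
     = of_real (sqrt (real (l choose k)) * sqrt (1 - a\<^sup>2) ^ k * a ^ (l - k)) * exp_raise (of_real a * \<xi>) p l"
proof -
  have pl: "p - k = (l - k) + (p - l)" "p - k - (l - k) = p - l" using assms by auto
  have "sqrt (real (p choose k)) * sqrt (fact (p - k) / fact (l - k)) = sqrt (real (l choose k)) * sqrt (fact p / fact l)"
    using assms by (simp add: binomial_fact real_sqrt_divide real_sqrt_mult)
  then have "sqrt (real (p choose k)) * (sqrt (fact (p - k) / fact (l - k)) / fact (p - l))
      = sqrt (real (l choose k)) * (sqrt (fact p / fact l) / fact (p - l))" by simp
  then have "complex_of_real (sqrt (real (p choose k)) * (sqrt (fact (p - k) / fact (l - k)) / fact (p - l)))
      = of_real (sqrt (real (l choose k)) * (sqrt (fact p / fact l) / fact (p - l)))" by (simp only:)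
  moreover have "of_real (att_coeff a k (p - k)) * exp_raise \<xi> (p - k) (l - k)
    = complex_of_real (sqrt (real (p choose k)) * (sqrt (fact (p - k) / fact (l - k)) / fact (p - l)))
      * (of_real (sqrt (1 - a\<^sup>2) ^ k * a ^ (l - k)) * (of_real a * \<xi>) ^ (p - l))"
  proof -
    have "a ^ (p - k) = a ^ (l - k) * a ^ (p - l)" unfolding pl(1) by (rule power_add)
    then show ?thesis
      using assms by (simp add: att_coeff_def exp_raise_def pl(2) power_mult_distrib mult_ac)
  qed
  moreover have "of_real (sqrt (real (l choose k)) * sqrt (1 - a\<^sup>2) ^ k * a ^ (l - k)) * exp_raise (of_real a * \<xi>) p l
    = complex_of_real (sqrt (real (l choose k)) * (sqrt (fact p / fact l) / fact (p - l)))
      * (of_real (sqrt (1 - a\<^sup>2) ^ k * a ^ (l - k)) * (of_real a * \<xi>) ^ (p - l))"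
    using assms by (simp add: exp_raise_def mult_ac)
  ultimately show ?thesis by simp
qed

text \<open>The action of the attenuator in the Heisenberg picture. At fixed
  \<open>l = k + j\<close> the sum over \<open>k\<close> has binomial total weight 1, which leaves
  the normally ordered expansion at \<open>a * \<xi>\<close>.\<close>

lemma att_disp:
  assumes a: "\<bar>a\<bar> \<le> 1"
  shows "(\<Sum>k\<le>min p q. of_real (att_coeff a k (p - k) * att_coeff a k (q - k)) * disp \<xi> (q - k) (p - k))
    = of_real (exp ((a\<^sup>2 - 1) * (cmod \<xi>)\<^sup>2 / 2)) * disp (of_real a * \<xi>) q p"
proof -
  define M where "M = min p q"
  define e where "e = complex_of_real (exp (- ((cmod \<xi>)\<^sup>2 / 2)))"
  define G where "G = (\<lambda>k j. (of_real (att_coeff a k (q - k)) * exp_raise \<xi> (q - k) j)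
      * cnj (of_real (att_coeff a k (p - k)) * exp_raise (- \<xi>) (p - k) j))"
  define H where "H = (\<lambda>l. exp_raise (of_real a * \<xi>) q l * cnj (exp_raise (- (of_real a * \<xi>)) p l))"
  have y: "0 \<le> 1 - a\<^sup>2" using a by (simp add: abs_square_le_1)
  have GH: "G k (l - k) = of_real (real (l choose k) * (1 - a\<^sup>2) ^ k * (a\<^sup>2) ^ (l - k)) * H l"
    if "k \<le> l" "l \<le> M" for k l
  proof -
    have l: "l \<le> p" "l \<le> q" using that by (auto simp: M_def)
    define w where "w = sqrt (real (l choose k)) * sqrt (1 - a\<^sup>2) ^ k * a ^ (l - k)"
    have "w * w = (sqrt (real (l choose k)) * sqrt (real (l choose k))) * (sqrt (1 - a\<^sup>2) * sqrt (1 - a\<^sup>2)) ^ k * (a * a) ^ (l - k)"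
      unfolding w_def power_mult_distrib by (simp only: mult_ac)
    also have "\<dots> = real (l choose k) * (1 - a\<^sup>2) ^ k * (a\<^sup>2) ^ (l - k)"
      using y by (simp add: power2_eq_square)
    finally have ww: "real (l choose k) * (1 - a\<^sup>2) ^ k * (a\<^sup>2) ^ (l - k) = w * w" ..
    show ?thesis
      unfolding G_def H_def att_coeff_exp_raise[OF that(1) l(1)] att_coeff_exp_raise[OF that(1) l(2)] ww
      by (simp add: w_def mult_ac)
  qed
  have "(\<Sum>k\<le>M. of_real (att_coeff a k (p - k) * att_coeff a k (q - k)) * disp \<xi> (q - k) (p - k))
    = e * (\<Sum>k\<le>M. \<Sum>j\<le>M - k. G k j)"
  proof -
    have "min (q - k) (p - k) = M - k" for k by (auto simp: M_def)
    then show ?thesis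
      by (simp add: disp_eq_exp_raise e_def G_def sum_distrib_left mult_ac)
  qed
  also have "(\<Sum>k\<le>M. \<Sum>j\<le>M - k. G k j) = (\<Sum>(k, j)\<in>{(i, j). i + j \<le> M}. G k j)"
    by (subst sum.Sigma) (auto intro!: sum.cong)
  also have "\<dots> = (\<Sum>l\<le>M. \<Sum>k\<le>l. G k (l - k))"
    by (rule sum.triangle_reindex_eq)
  also have "\<dots> = (\<Sum>l\<le>M. H l)"
  proof (intro sum.cong refl)
    fix l assume "l \<in> {..M}"
    then have "(\<Sum>k\<le>l. G k (l - k)) = of_real (\<Sum>k\<le>l. real (l choose k) * (1 - a\<^sup>2) ^ k * (a\<^sup>2) ^ (l - k)) * H l"
      unfolding of_real_sum sum_distrib_right by (intro sum.cong refl) (auto simp: GH)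
    then show "(\<Sum>k\<le>l. G k (l - k)) = H l" unfolding of_real_binomial_sum by simp
  qed
  also have "e * (\<Sum>l\<le>M. H l) = of_real (exp ((a\<^sup>2 - 1) * (cmod \<xi>)\<^sup>2 / 2)) * disp (of_real a * \<xi>) q p"
  proof -
    have "e = of_real (exp ((a\<^sup>2 - 1) * (cmod \<xi>)\<^sup>2 / 2)) * of_real (exp (- ((cmod (of_real a * \<xi>))\<^sup>2 / 2)))"
      unfolding e_def of_real_mult[symmetric] exp_add[symmetric]
      by (simp add: norm_mult power_mult_distrib field_simps)
    then show ?thesis
      by (simp add: disp_eq_exp_raise H_def M_def min.commute mult_ac)
  qed
  finally show ?thesis unfolding M_def .
qed

lemma scaling_CP_att:
  assumes a: "\<bar>a\<bar> \<le> 1"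
  shows "scaling_CP 1 a"
proof -
  interpret kraus_channel "att_coeff a" "\<lambda>k m. m + k" using a by (rule kraus_channel_att)
  have "chi 1 \<xi> (kraus \<rho>) = chi 1 (of_real a * \<xi>) \<rho>" if "density_op \<rho>" for \<rho> \<xi>
  proof -
    have \<rho>: "pos_tc \<rho>" using that by (simp add: density_op_def)
    define z where "z = (cmod \<xi>)\<^sup>2"
    define E where "E = (\<lambda>q p. of_real (exp ((a\<^sup>2 - 1) * z / 2)) * disp (of_real a * \<xi>) q p)"
    have lim: "(\<lambda>N. dual (disp \<xi>) N (r N) q p) \<longlonglongrightarrow> E q p" if r: "\<And>N. N \<le> r N" for r p q
    \<comment> \<open>At most \<open>min p q\<close> quanta can be lost here, so the truncated dual
      is exact once \<open>N\<close> exceeds \<open>p\<close> and \<open>q\<close>.\<close>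
    proof (rule tendsto_eventually, rule eventually_mono[OF eventually_gt_at_top[of "max p q"]])
      fix N :: nat assume N: "max p q < N"
      have "dual (disp \<xi>) N (r N) q p
        = (\<Sum>k\<in>{..min p q}. of_real (att_coeff a k (p - k) * att_coeff a k (q - k)) * disp \<xi> (q - k) (p - k))"
        using N r[of N] by (intro dual_eq_sum) auto
      then show "dual (disp \<xi>) N (r N) q p = E q p"
        using att_disp[OF a] by (simp add: E_def z_def)
    qed
    have E: "contraction E" by (rule tr_mul_kraus(1)[OF \<rho> contraction_disp lim])
    have "tr_mul (kraus \<rho>) (disp \<xi>) = tr_mul \<rho> E"
      by (rule tr_mul_kraus(2)[OF \<rho> contraction_disp lim])
    also have "\<dots> = of_real (exp ((a\<^sup>2 - 1) * z / 2)) * tr_mul \<rho> (disp (of_real a * \<xi>))"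
      by (rule tr_mul_scale[OF \<rho> contraction_disp E]) (simp add: E_def)
    finally have "chi 1 \<xi> (kraus \<rho>) = of_real (exp (z / 2) * exp ((a\<^sup>2 - 1) * z / 2)) * tr_mul \<rho> (disp (of_real a * \<xi>))"
      by (simp add: chi_def z_def)
    also have "exp (z / 2) * exp ((a\<^sup>2 - 1) * z / 2) = exp (1 * (cmod (of_real a * \<xi>))\<^sup>2 / 2)"
      unfolding exp_add[symmetric] by (simp add: z_def norm_mult power_mult_distrib field_simps)
    finally show ?thesis by (simp add: chi_def)
  qed
  then show ?thesis unfolding scaling_CP_def using cptp_kraus by blast
qed

section \<open>The amplifier and antinormal ordering\<close>

text \<open>Fubini: absolute summability of \<open>H\<close> carries over to the double family
  because each row of weights is a probability distribution.\<close>

lemma weighted_sums_swap: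
  fixes H :: "nat \<Rightarrow> complex" and w :: "nat \<Rightarrow> nat \<Rightarrow> real"
  assumes w: "\<And>i k. 0 \<le> w i k" "\<And>i. w i sums 1"
    and H: "summable (\<lambda>i. norm (H i))" and R: "\<And>k. (\<lambda>i. of_real (w i k) * H i) sums R k"
  shows "R sums (\<Sum>i. H i)"
proof -
  define F where "F = (\<lambda>(i, k). of_real (w i k) * H i)"
  have w1: "(w i has_sum 1) UNIV" for i using w by (intro sums_nonneg_imp_has_sum)
  have nF: "norm (F (i, k)) = w i k * norm (H i)" for i k
    using w(1) by (simp add: F_def norm_mult)
  have inner_norm: "((\<lambda>k. norm (F (i, k))) has_sum norm (H i)) UNIV" for i
    unfolding nF using has_sum_cmult_left[OF w1[of i], of "norm (H i)"] by simp
  have "(\<lambda>x. norm (F x)) summable_on (Sigma UNIV (\<lambda>_. UNIV))"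
    unfolding Infinite_Sum.abs_summable_on_Sigma_iff
  proof (intro conjI ballI)
    fix i show "(\<lambda>k. norm (F (i, k))) summable_on UNIV" by (rule has_sum_imp_summable[OF inner_norm])
  next
    show "(\<lambda>i. norm (infsum (\<lambda>k. norm (F (i, k))) UNIV)) summable_on UNIV"
      unfolding infsumI[OF inner_norm] real_norm_def abs_norm_cancel
      using H by (intro summable_nonneg_imp_summable_on) auto
  qed
  then have S: "(F has_sum infsum F (UNIV \<times> UNIV)) (UNIV \<times> UNIV)" (is "(F has_sum ?S) _")
    by (rule has_sum_infsum[OF abs_summable_summable])
  have "((\<lambda>k. F (i, k)) has_sum H i) UNIV" for i
    using has_sum_cmult_left[OF has_sum_of_real[OF w1[of i]], of "H i"] by (simp add: F_def)
  then have "(H has_sum ?S) UNIV" by (intro has_sum_SigmaD[OF S])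
  then have HS: "(\<Sum>i. H i) = ?S" by (intro sums_unique[symmetric] has_sum_imp_sums)
  have "(F has_sum ?S) (UNIV \<times> UNIV) \<longleftrightarrow> ((\<lambda>(k, i). F (i, k)) has_sum ?S) (UNIV \<times> UNIV)"
    by (rule has_sum_reindex_bij_witness[where i = prod.swap and j = prod.swap]) auto
  then have S': "((\<lambda>(k, i). F (i, k)) has_sum ?S) (UNIV \<times> UNIV)" using S by (simp only:)
  have "((\<lambda>i. F (i, k)) has_sum R k) UNIV" for k
  proof -
    have "(\<lambda>i. F (i, k)) summable_on UNIV"
      by (rule summable_on_SigmaD1[OF has_sum_imp_summable[OF S']]) simp
    then have *: "((\<lambda>i. F (i, k)) has_sum infsum (\<lambda>i. F (i, k)) UNIV) UNIV" by (rule has_sum_infsum)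
    then have "infsum (\<lambda>i. F (i, k)) UNIV = R k"
      using sums_unique2[OF has_sum_imp_sums[OF *]] R[of k] by (simp add: F_def)
    with * show ?thesis by (simp only:)
  qed
  then have "(R has_sum ?S) UNIV" by (intro has_sum_SigmaD[OF S']) simp
  then show ?thesis unfolding HS by (rule has_sum_imp_sums)
qed

text \<open>The amplitude for adding \<open>k\<close> quanta at gain \<open>a\<^sup>2\<close>. The
  extra factor \<open>\<bar>inverse a\<bar>\<close> supplies the additional power in the negative
  binomial law; the guard excludes pairs with \<open>m < k\<close>, for which \<open>m - k\<close>
  is 0.\<close>

definition amp_coeff :: "real \<Rightarrow> nat \<Rightarrow> nat \<Rightarrow> real" where
  "amp_coeff a k m = (if k \<le> m then
     sqrt (real (m choose k)) * inverse a ^ (m - k) * \<bar>inverse a\<bar> * sqrt (1 - (inverse a)\<^sup>2) ^ k else 0)"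

lemma inverse_square_bounds:
  fixes a :: real
  assumes "1 < \<bar>a\<bar>"
  shows "0 \<le> 1 - (inverse a)\<^sup>2" "1 - (inverse a)\<^sup>2 < 1"
proof -
  have "\<bar>inverse a\<bar> \<le> 1" "a \<noteq> 0" using assms by (auto simp: field_simps)
  then show "0 \<le> 1 - (inverse a)\<^sup>2" "1 - (inverse a)\<^sup>2 < 1" by (auto simp: abs_square_le_1)
qed

lemma kraus_channel_amp:
  assumes a: "1 < \<bar>a\<bar>"
  shows "kraus_channel (amp_coeff a) (\<lambda>k m. m - k)"
proof
  fix p :: nat
  define y where "y = 1 - (inverse a)\<^sup>2"
  have y: "0 \<le> y" "y < 1" using inverse_square_bounds[OF a] by (auto simp: y_def)
  have "(amp_coeff a k (p + k))\<^sup>2 = real (p + k choose k) * y ^ k * (1 - y) ^ Suc p" for k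
    using y(1) by (simp add: power_inverse amp_coeff_def y_def power_mult_distrib power_square_commute mult_ac)
  then have "(\<lambda>k. (amp_coeff a k (p + k))\<^sup>2) sums 1"
    using negative_binomial_sums[OF y, of p] by simp
  then have "((\<lambda>k. (amp_coeff a k (p + k))\<^sup>2) has_sum 1) UNIV"
    by (intro sums_nonneg_imp_has_sum) auto
  also have "?this \<longleftrightarrow> ((\<lambda>(k, m). (amp_coeff a k m)\<^sup>2) has_sum 1) (range (\<lambda>k. (k, p + k)))"
    by (rule has_sum_reindex_bij_witness[where i = fst and j = "\<lambda>k. (k, p + k)"]) auto
  also have "\<dots> \<longleftrightarrow> ((\<lambda>(k, m). (amp_coeff a k m)\<^sup>2) has_sum 1) {(k, m). m - k = p}"
    by (rule has_sum_cong_neutral) (auto simp: amp_coeff_def image_iff)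
  finally show "((\<lambda>(k, m). (amp_coeff a k m)\<^sup>2) has_sum 1) {(k, m). m - k = p}" .
qed

text \<open>The antinormal counterpart of \<open>att_coeff_exp_raise\<close>: the coefficient left
  over depends on \<open>i\<close> and \<open>k\<close>, where \<open>i\<close> is the row index
  summed in the antinormal expansion.\<close>

lemma amp_coeff_exp_raise:
  assumes a: "a \<noteq> 0"
  shows "of_real (amp_coeff a k (p + k)) * exp_raise \<xi> (i + k) (p + k)
     = of_real (sqrt (real (i + k choose k)) * sqrt (1 - (inverse a)\<^sup>2) ^ k * \<bar>inverse a\<bar> * inverse a ^ i)
        * exp_raise (of_real a * \<xi>) i p"
proof (cases "p \<le> i")
  case False
  then show ?thesis by (simp add: exp_raise_def)
next
  case True
  define t where "t = sqrt (1 - (inverse a)\<^sup>2) ^ k"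
  define b where "b = inverse a"
  have "sqrt (real (p + k choose k)) * (sqrt (fact (i + k) / fact (p + k)) / fact (i - p))
      = sqrt (real (i + k choose k)) * (sqrt (fact i / fact p) / fact (i - p))"
    by (simp add: binomial_fact real_sqrt_divide real_sqrt_mult)
  then have 1: "complex_of_real (sqrt (real (p + k choose k)) * (sqrt (fact (i + k) / fact (p + k)) / fact (i - p)))
      = of_real (sqrt (real (i + k choose k)) * (sqrt (fact i / fact p) / fact (i - p)))" by (simp only:)
  \<comment> \<open>Trading \<open>b ^ p\<close> for \<open>b ^ i\<close> produces the powers of
    \<open>a\<close> that rescale \<open>\<xi>\<close>.\<close>
  have "b ^ i * a ^ (i - p) = b ^ p * (b * a) ^ (i - p)"
    using True by (simp add: power_mult_distrib flip: power_add)
  then have 2: "complex_of_real (b ^ p) = of_real (b ^ i * a ^ (i - p))"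
    using a by (simp add: b_def)
  have "of_real (amp_coeff a k (p + k)) * exp_raise \<xi> (i + k) (p + k)
    = complex_of_real (sqrt (real (p + k choose k)) * (sqrt (fact (i + k) / fact (p + k)) / fact (i - p)))
      * of_real t * of_real \<bar>b\<bar> * (of_real (b ^ p) * \<xi> ^ (i - p))"
    using True by (simp add: amp_coeff_def exp_raise_def t_def b_def)
  also have "\<dots> = of_real (sqrt (real (i + k choose k)) * t * \<bar>b\<bar> * b ^ i) * exp_raise (of_real a * \<xi>) i p"
    unfolding 1 2 using True by (simp add: exp_raise_def power_mult_distrib)
  finally show ?thesis by (simp only: t_def b_def)
qed

lemma norm_exp_raise: "of_real (cmod (exp_raise \<alpha> m k)) = exp_raise (of_real (cmod \<alpha>)) m k"
  by (simp add: exp_raise_def norm_mult norm_power norm_divide)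

text \<open>Absolute values of the entries are entries for the parameter
  \<open>cmod \<alpha>\<close>, for which the series converges by the commutation relation.\<close>

lemma summable_norm_exp_raise:
  "summable (\<lambda>j. norm (cnj (exp_raise (- \<alpha>) j m) * exp_raise \<alpha> j n))"
proof -
  have "summable (\<lambda>j. cnj (exp_raise (of_real (cmod \<alpha>)) j m) * exp_raise (of_real (cmod \<alpha>)) j n)"
    using exp_raise_antinormal by (rule sums_summable)
  also have "(\<lambda>j. cnj (exp_raise (of_real (cmod \<alpha>)) j m) * exp_raise (of_real (cmod \<alpha>)) j n)
      = (\<lambda>j. of_real (norm (cnj (exp_raise (- \<alpha>) j m) * exp_raise \<alpha> j n)))"
    using norm_exp_raise[of "- \<alpha>"] by (simp add: norm_mult norm_exp_raise[symmetric])
  finally show ?thesis by (simp only: summable_of_real_iff)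
qed

text \<open>The antinormal expansion is an infinite series in \<open>i\<close>, so two infinite sums
  must be exchanged; for fixed \<open>i\<close> the Kraus weights form a negative binomial law of
  total mass 1.\<close>

lemma amp_disp:
  assumes a: "1 < \<bar>a\<bar>"
  shows "(\<lambda>k. of_real (amp_coeff a k (p + k) * amp_coeff a k (q + k)) * disp \<xi> (q + k) (p + k)) sums
    (of_real (exp ((1 - a\<^sup>2) * (cmod \<xi>)\<^sup>2 / 2)) * disp (of_real a * \<xi>) q p)"
proof -
  define y where "y = 1 - (inverse a)\<^sup>2"
  have y: "0 \<le> y" "y < 1" using inverse_square_bounds[OF a] by (auto simp: y_def)
  define H where "H = (\<lambda>i. cnj (exp_raise (- (of_real a * \<xi>)) i q) * exp_raise (of_real a * \<xi>) i p)"
  define w where "w = (\<lambda>i k. real (i + k choose k) * y ^ k * (1 - y) ^ Suc i)"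
  define e where "e = exp (- ((cmod \<xi>)\<^sup>2 / 2))"
  define R where "R = (\<lambda>k. of_real (amp_coeff a k (p + k) * amp_coeff a k (q + k)) * (of_real e * disp \<xi> (q + k) (p + k)))"
  have coeff: "of_real (amp_coeff a k (p + k) * amp_coeff a k (q + k)) *
      (cnj (exp_raise (- \<xi>) (i + k) (q + k)) * exp_raise \<xi> (i + k) (p + k)) = of_real (w i k) * H i" for i k
  proof -
    define v where "v = sqrt (real (i + k choose k)) * sqrt y ^ k * \<bar>inverse a\<bar> * inverse a ^ i"
    have "v * v = (sqrt (real (i + k choose k)) * sqrt (real (i + k choose k))) * (sqrt y * sqrt y) ^ k
        * (\<bar>inverse a\<bar> * \<bar>inverse a\<bar>) * (inverse a * inverse a) ^ i"
      unfolding v_def power_mult_distrib by (simp only: mult_ac)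
    also have "\<bar>inverse a\<bar> * \<bar>inverse a\<bar> = inverse a * inverse a" by (rule abs_mult_self_eq)
    also have "sqrt (real (i + k choose k)) * sqrt (real (i + k choose k)) * (sqrt y * sqrt y) ^ k
        * (inverse a * inverse a) * (inverse a * inverse a) ^ i = w i k"
      using y by (simp add: w_def y_def power2_eq_square)
    finally have vw: "w i k = v * v" ..
    have "of_real (amp_coeff a k (p + k) * amp_coeff a k (q + k)) *
      (cnj (exp_raise (- \<xi>) (i + k) (q + k)) * exp_raise \<xi> (i + k) (p + k))
      = cnj (of_real (amp_coeff a k (q + k)) * exp_raise (- \<xi>) (i + k) (q + k))
        * (of_real (amp_coeff a k (p + k)) * exp_raise \<xi> (i + k) (p + k))"
      by (simp add: mult_ac)
    also have "\<dots> = of_real (w i k) * H i"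
      using a by (subst (1 2) amp_coeff_exp_raise) (auto simp: H_def vw v_def y_def mult_ac)
    finally show ?thesis .
  qed
  have "R sums (\<Sum>i. H i)"
  proof (rule weighted_sums_swap)
    show "0 \<le> w i k" for i k using y by (simp add: w_def)
    show "w i sums 1" for i unfolding w_def by (rule negative_binomial_sums[OF y])
    show "summable (\<lambda>i. norm (H i))" unfolding H_def by (rule summable_norm_exp_raise)
    fix k
    \<comment> \<open>The first \<open>k\<close> terms of the antinormal series vanish by
      triangularity, so the index may be shifted.\<close>
    have "(\<lambda>i. cnj (exp_raise (- \<xi>) (i + k) (q + k)) * exp_raise \<xi> (i + k) (p + k)) sums (of_real e * disp \<xi> (q + k) (p + k))"
      unfolding e_def using disp_antinormal[of \<xi> "q + k" "p + k"]
      by (subst sums_zero_iff_shift) (auto simp: exp_raise_def)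
    then show "(\<lambda>i. of_real (w i k) * H i) sums R k"
      unfolding R_def coeff[symmetric] by (rule sums_mult)
  qed
  moreover have "(\<Sum>i. H i) = of_real (exp (- ((cmod (of_real a * \<xi>))\<^sup>2 / 2))) * disp (of_real a * \<xi>) q p"
    unfolding H_def by (rule sums_unique[symmetric, OF disp_antinormal])
  ultimately have "(\<lambda>k. of_real (inverse e) * R k) sums
     (of_real (inverse e) * (of_real (exp (- ((cmod (of_real a * \<xi>))\<^sup>2 / 2))) * disp (of_real a * \<xi>) q p))"
    by (intro sums_mult) simp
  moreover have "of_real (inverse e) * R k = of_real (amp_coeff a k (p + k) * amp_coeff a k (q + k)) * disp \<xi> (q + k) (p + k)" for k
    by (simp add: R_def e_def)
  moreover have "inverse e * exp (- ((cmod (of_real a * \<xi>))\<^sup>2 / 2)) = exp ((1 - a\<^sup>2) * (cmod \<xi>)\<^sup>2 / 2)"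
    unfolding e_def exp_minus[symmetric] exp_add[symmetric]
    by (simp add: norm_mult power_mult_distrib field_simps)
  ultimately show ?thesis by (simp only: mult.assoc[symmetric] of_real_mult[symmetric])
qed

lemma scaling_CP_amp:
  assumes a: "1 < \<bar>a\<bar>"
  shows "scaling_CP (- 1) a"
proof -
  interpret kraus_channel "amp_coeff a" "\<lambda>k m. m - k" using a by (rule kraus_channel_amp)
  have "chi (- 1) \<xi> (kraus \<rho>) = chi (- 1) (of_real a * \<xi>) \<rho>" if "density_op \<rho>" for \<rho> \<xi>
  proof -
    have \<rho>: "pos_tc \<rho>" using that by (simp add: density_op_def)
    define z where "z = (cmod \<xi>)\<^sup>2"
    define E where "E = (\<lambda>q p. of_real (exp ((1 - a\<^sup>2) * z / 2)) * disp (of_real a * \<xi>) q p)"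
    have lim: "(\<lambda>N. dual (disp \<xi>) N (r N) q p) \<longlonglongrightarrow> E q p" if r: "\<And>N. N \<le> r N" for r p q
    proof -
      \<comment> \<open>The corner size alone limits the sum, through
        \<open>k + max p q < N\<close>; any \<open>r N \<ge> N\<close> leaves these partial sums
        unchanged.\<close>
      have "dual (disp \<xi>) N (r N) q p = (\<Sum>k\<in>{..<N - max p q}.
          of_real (amp_coeff a k (p + k) * amp_coeff a k (q + k)) * disp \<xi> (q + k) (p + k))" for N
        using r[of N] by (intro dual_eq_sum) (auto simp: amp_coeff_def split: if_splits)
      moreover have "filterlim (\<lambda>N. N - max p q) at_top sequentially"
        by (rule filterlim_minus_const_nat_at_top)
      ultimately show ?thesis
        using filterlim_compose[OF amp_disp[OF a, of p q \<xi>, unfolded sums_def]] by (simp add: E_def z_def)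
    qed
    have E: "contraction E" by (rule tr_mul_kraus(1)[OF \<rho> contraction_disp lim])
    have "tr_mul (kraus \<rho>) (disp \<xi>) = tr_mul \<rho> E"
      by (rule tr_mul_kraus(2)[OF \<rho> contraction_disp lim])
    also have "\<dots> = of_real (exp ((1 - a\<^sup>2) * z / 2)) * tr_mul \<rho> (disp (of_real a * \<xi>))"
      by (rule tr_mul_scale[OF \<rho> contraction_disp E]) (simp add: E_def)
    finally have "chi (- 1) \<xi> (kraus \<rho>) = of_real (exp (- z / 2) * exp ((1 - a\<^sup>2) * z / 2)) * tr_mul \<rho> (disp (of_real a * \<xi>))"
      by (simp add: chi_def z_def)
    also have "exp (- z / 2) * exp ((1 - a\<^sup>2) * z / 2) = exp (- 1 * (cmod (of_real a * \<xi>))\<^sup>2 / 2)"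
      unfolding exp_add[symmetric] by (simp add: z_def norm_mult power_mult_distrib field_simps)
    finally show ?thesis by (simp add: chi_def)
  qed
  then show ?thesis unfolding scaling_CP_def using cptp_kraus by blast
qed

text \<open>Rescaling by modulus 1 leaves the \<open>s\<close>-dependent factor of
  \<open>chi\<close> unchanged, so the channel for \<open>s = 1\<close> serves every
  ordering.\<close>

lemma scaling_CP_unit:
  assumes a: "\<bar>a\<bar> = 1"
  shows "scaling_CP s a"
proof -
  obtain \<Phi> where \<Phi>: "cptp \<Phi>" "\<And>\<rho> \<xi>. density_op \<rho> \<Longrightarrow> chi 1 \<xi> (\<Phi> \<rho>) = chi 1 (of_real a * \<xi>) \<rho>"
    using scaling_CP_att[of a] a unfolding scaling_CP_def by auto
  have "chi s \<xi> (\<Phi> \<rho>) = chi s (of_real a * \<xi>) \<rho>" if "density_op \<rho>" for \<rho> \<xi>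
    using \<Phi>(2)[OF that, of \<xi>] a by (simp add: chi_def norm_mult)
  then show ?thesis using \<Phi>(1) unfolding scaling_CP_def by blast
qed


section \<open>Radial characteristic functions\<close>

definition laguerre :: "nat \<Rightarrow> real \<Rightarrow> real" where
  "laguerre n x = (\<Sum>i\<le>n. real (n choose i) / fact i * (- x) ^ i)"

lemma disp_diag: "disp \<xi> n n = of_real (exp (- ((cmod \<xi>)\<^sup>2 / 2)) * laguerre n ((cmod \<xi>)\<^sup>2))"
proof -
  have *: "complex_of_real (sqrt (fact n * fact n) / (fact k * fact (n - k) * fact (n - k))) * \<xi> ^ (n - k) * (- cnj \<xi>) ^ (n - k)
      = of_real (real (n choose (n - k)) / fact (n - k) * (- ((cmod \<xi>)\<^sup>2)) ^ (n - k))" if "k \<le> n" for k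
  proof -
    have "\<xi> ^ (n - k) * (- cnj \<xi>) ^ (n - k) = of_real ((- ((cmod \<xi>)\<^sup>2)) ^ (n - k))"
    proof -
      have "\<xi> * - cnj \<xi> = of_real (- ((cmod \<xi>)\<^sup>2))"
        by (simp only: mult_minus_right complex_norm_square[symmetric] of_real_minus)
      then show ?thesis by (simp only: power_mult_distrib[symmetric] of_real_power)
    qed
    moreover have "sqrt (fact n * fact n) / (fact k * fact (n - k) * fact (n - k)) = real (n choose (n - k)) / fact (n - k)"
      using that by (simp add: binomial_fact)
    ultimately show ?thesis by (simp only: of_real_mult mult.assoc)
  qed
  have "(\<Sum>k\<le>n. complex_of_real (sqrt (fact n * fact n) / (fact k * fact (n - k) * fact (n - k))) * \<xi> ^ (n - k) * (- cnj \<xi>) ^ (n - k))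
     = (\<Sum>k\<le>n. of_real (real (n choose (n - k)) / fact (n - k) * (- ((cmod \<xi>)\<^sup>2)) ^ (n - k)))"
    by (intro sum.cong refl *) simp
  also have "\<dots> = of_real (laguerre n ((cmod \<xi>)\<^sup>2))"
    unfolding laguerre_def of_real_sum
    by (rule sum.reindex_bij_witness[where i = "\<lambda>i. n - i" and j = "\<lambda>i. n - i"]) auto
  finally show ?thesis unfolding disp_def by (simp flip: exp_of_real)
qed

text \<open>The bound is uniform in \<open>n\<close> because the function is a diagonal entry of a
  contraction.\<close>

lemma laguerre_bound:
  assumes "0 \<le> x"
  shows "\<bar>exp (- (x / 2)) * laguerre n x\<bar> \<le> 1"
proof -
  have "cmod (disp (of_real (sqrt x)) n n) \<le> 1" by (intro contraction_entry contraction_disp)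
  moreover have "(cmod (of_real (sqrt x)))\<^sup>2 = x" using assms by simp
  ultimately show ?thesis unfolding disp_diag by (simp only: norm_of_real)
qed

text \<open>Covariance under phase rotation: the exponents \<open>m - k\<close> and
  \<open>n - k\<close> differ from \<open>m\<close> and \<open>n\<close> by powers of
  \<open>u * cnj u = 1\<close>.\<close>

lemma disp_rotate:
  assumes "cmod u = 1"
  shows "disp (u * \<xi>) m n = u ^ m * cnj u ^ n * disp \<xi> m n"
proof -
  have uu: "u * cnj u = 1" using assms complex_norm_square[of u] by simp
  have "exp_raise (u * \<xi>) m k * cnj (exp_raise (- (u * \<xi>)) n k)
      = u ^ m * cnj u ^ n * (exp_raise \<xi> m k * cnj (exp_raise (- \<xi>) n k))" if "k \<le> min m n" for k
  proof -
    have "u ^ m * cnj u ^ n = u ^ (m - k) * cnj u ^ (n - k) * (u * cnj u) ^ k"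
      using that unfolding power_mult_distrib by (simp add: mult_ac flip: power_add)
    also have "\<dots> = u ^ (m - k) * cnj u ^ (n - k)" by (simp add: uu)
    finally have e: "u ^ m * cnj u ^ n = u ^ (m - k) * cnj u ^ (n - k)" .
    have "exp_raise (v * \<xi>) m k = v ^ (m - k) * exp_raise \<xi> m k" for v \<xi> m
      by (simp add: exp_raise_def power_mult_distrib)
    from this[of u \<xi> m] this[of u "- \<xi>" n] show ?thesis unfolding e by (simp add: mult_ac)
  qed
  then have "(\<Sum>k\<le>min m n. exp_raise (u * \<xi>) m k * cnj (exp_raise (- (u * \<xi>)) n k))
     = u ^ m * cnj u ^ n * (\<Sum>k\<le>min m n. exp_raise \<xi> m k * cnj (exp_raise (- \<xi>) n k))"
    unfolding sum_distrib_left by (intro sum.cong refl) simp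
  then show ?thesis using assms unfolding disp_eq_exp_raise by (simp add: norm_mult mult_ac)
qed

lemma root_of_unity_orthogonal:
  assumes "0 < K"
  obtains u where "\<And>j. cmod (u j) = 1"
    "\<And>m n. m < K \<Longrightarrow> n < K \<Longrightarrow> (\<Sum>j<K. u j ^ m * cnj (u j) ^ n) = (if m = n then of_nat K else 0)"
proof -
  define w where "w = (\<lambda>j. exp (2 * of_real pi * \<i> * of_nat j / of_nat K))"
  have K: "1 \<le> K" using assms by simp
  have norm: "cmod (w j) = 1" for j
    using norm_exp_i_times[of "2 * pi * real j / real K"] by (simp add: w_def mult_ac)
  have pow: "w j ^ m = w m ^ j" for j m
    unfolding w_def exp_of_nat_mult[symmetric] by (simp add: mult_ac)
  have "(\<Sum>j<K. w j ^ m * cnj (w j) ^ n) = (if m = n then of_nat K else 0)" if "m < K" "n < K" for m n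
  proof -
    define z where "z = w m * cnj (w n)"
    have uu: "w n * cnj (w n) = 1" for n using norm[of n] complex_norm_square[of "w n"] by simp
    have "(\<Sum>j<K. w j ^ m * cnj (w j) ^ n) = (\<Sum>j<K. z ^ j)"
    proof (intro sum.cong refl)
      fix j
      have "w j ^ m * cnj (w j ^ n) = w m ^ j * cnj (w n ^ j)" by (simp only: pow[of j m] pow[of j n])
      then show "w j ^ m * cnj (w j) ^ n = z ^ j" by (simp add: z_def power_mult_distrib)
    qed
    also have "\<dots> = (if m = n then of_nat K else 0)"
    proof (cases "m = n")
      case True
      then show ?thesis using uu by (simp add: z_def)
    next
      case False
      have wK: "w m ^ K = 1" for m
      proof -
        have "w m ^ K = exp (of_nat K * (2 * of_real pi * \<i> * of_nat m / of_nat K))"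
          unfolding w_def by (rule exp_of_nat_mult[symmetric])
        also have "of_nat K * (2 * of_real pi * \<i> * of_nat m / of_nat K) = of_nat m * (2 * of_real pi * \<i>)"
          using K by simp
        finally show ?thesis by (simp only: exp_of_nat_mult exp_two_pi_i power_one)
      qed
      have "z \<noteq> 1"
      proof
        assume "z = 1"
        then have "w n * (w m * cnj (w n)) = w n" by (simp add: z_def)
        then have "w m * (w n * cnj (w n)) = w n" by (simp add: mult_ac)
        then have "w m = w n" using uu by simp
        then have "m mod K = n mod K" using complex_root_unity_eq[OF K, of m n] by (simp add: w_def)
        then show False using False that by simp
      qed
      moreover have "z ^ K = 1"
        unfolding z_def power_mult_distrib using wK[of m] wK[of n] by (simp flip: complex_cnj_power)
      ultimately show ?thesis using False by (simp add: geometric_sum)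
    qed
    finally show ?thesis .
  qed
  then show ?thesis by (rule that[OF norm])
qed

text \<open>Averaging a radial characteristic function over the \<open>K\<close>-th roots of unity removes the
  off-diagonal entries of the \<open>K \<times> K\<close> corner.\<close>

lemma radial_tr_mul_sums:
  assumes \<sigma>: "pos_tc \<sigma>" and radial: "\<And>u \<xi>. cmod u = 1 \<Longrightarrow> tr_mul \<sigma> (disp (u * \<xi>)) = tr_mul \<sigma> (disp \<xi>)"
  shows "(\<lambda>n. \<sigma> n n * disp \<xi> n n) sums tr_mul \<sigma> (disp \<xi>)"
proof -
  have "cmod ((\<Sum>n<K. \<sigma> n n * disp \<xi> n n) - tr_mul \<sigma> (disp \<xi>)) \<le> trunc_err \<sigma> K" if K: "0 < K" for K
  proof -
    obtain u where u: "\<And>j. cmod (u j) = 1"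
      "\<And>m n. m < K \<Longrightarrow> n < K \<Longrightarrow> (\<Sum>j<K. u j ^ m * cnj (u j) ^ n) = (if m = n then of_nat K else 0)"
      using root_of_unity_orthogonal[OF K] by blast
    have "(\<Sum>j<K. trunc \<sigma> (disp (u j * \<xi>)) K K)
       = (\<Sum>j<K. \<Sum>n<K. \<Sum>m<K. \<sigma> n m * disp \<xi> m n * (u j ^ m * cnj (u j) ^ n))"
      unfolding trunc_def disp_rotate[OF u(1)] by (simp add: mult_ac)
    also have "\<dots> = (\<Sum>n<K. \<Sum>j<K. \<Sum>m<K. \<sigma> n m * disp \<xi> m n * (u j ^ m * cnj (u j) ^ n))"
      by (rule sum.swap)
    also have "\<dots> = (\<Sum>n<K. \<Sum>m<K. \<Sum>j<K. \<sigma> n m * disp \<xi> m n * (u j ^ m * cnj (u j) ^ n))"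
      by (intro sum.cong refl sum.swap)
    also have "\<dots> = (\<Sum>n<K. \<Sum>m<K. if m = n then of_nat K * (\<sigma> n n * disp \<xi> n n) else 0)"
      unfolding sum_distrib_left[symmetric] by (intro sum.cong refl) (auto simp: u(2))
    also have "\<dots> = of_nat K * (\<Sum>n<K. \<sigma> n n * disp \<xi> n n)"
      by (simp add: sum_distrib_left)
    \<comment> \<open>The deviation is now a mean of \<open>K\<close> corner errors, each at most
      \<open>trunc_err \<sigma> K\<close>, so a finite average replaces an integral over the
      circle.\<close>
    finally have eq: "of_nat K * ((\<Sum>n<K. \<sigma> n n * disp \<xi> n n) - tr_mul \<sigma> (disp \<xi>))
       = (\<Sum>j<K. trunc \<sigma> (disp (u j * \<xi>)) K K - tr_mul \<sigma> (disp (u j * \<xi>)))"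
      by (simp add: radial u(1) sum_subtractf right_diff_distrib)
    have "real K * cmod ((\<Sum>n<K. \<sigma> n n * disp \<xi> n n) - tr_mul \<sigma> (disp \<xi>))
       = cmod (\<Sum>j<K. trunc \<sigma> (disp (u j * \<xi>)) K K - tr_mul \<sigma> (disp (u j * \<xi>)))"
      unfolding eq[symmetric] by (simp add: norm_mult)
    also have "\<dots> \<le> (\<Sum>j<K. trunc_err \<sigma> K)"
      by (intro sum_norm_le) (subst norm_minus_commute, rule tr_mul_trunc[OF \<sigma> contraction_disp])
    finally show ?thesis using K by simp
  qed
  then have "(\<lambda>K. (\<Sum>n<K. \<sigma> n n * disp \<xi> n n) - tr_mul \<sigma> (disp \<xi>)) \<longlonglongrightarrow> 0"
    by (intro Lim_null_comparison[OF _ trunc_err_tendsto[OF \<sigma>]] eventually_mono[OF eventually_gt_at_top[of 0]])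
  then show ?thesis unfolding sums_def by (simp add: LIM_zero_iff)
qed

section \<open>Number probabilities from Laplace integrals\<close>

definition exp_moment :: "nat \<Rightarrow> real \<Rightarrow> real \<Rightarrow> real" where
  "exp_moment i l x = (if x < 0 then 0 else x ^ i * exp (- l * x))"

lemma exp_moment_integral:
  assumes l: "0 < l"
  shows "has_bochner_integral lborel (exp_moment i l) (fact i / l ^ Suc i)"
proof -
  have "has_bochner_integral lborel (\<lambda>x. erlang_density 0 l x * x ^ i) (fact i / l ^ i)"
  proof (rule has_bochner_integral_nn_integral)
    show "AE x in lborel. 0 \<le> erlang_density 0 l x * x ^ i"
      using l by (auto simp: erlang_density_def)
    show "(\<integral>\<^sup>+ x. ennreal (erlang_density 0 l x * x ^ i) \<partial>lborel) = ennreal (fact i / l ^ i)"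
      using nn_integral_erlang_ith_moment[OF l, of 0 i] by simp
  qed (use l in auto)
  from has_bochner_integral_mult_right[OF this, of "1 / l"]
  have "has_bochner_integral lborel (\<lambda>x. 1 / l * (erlang_density 0 l x * x ^ i)) (fact i / l ^ Suc i)"
    by simp
  also have "(\<lambda>x. 1 / l * (erlang_density 0 l x * x ^ i)) = exp_moment i l"
    using l by (intro ext) (simp add: erlang_density_def exp_moment_def)
  finally show ?thesis .
qed

text \<open>Orthonormality of the functions exp (- x / 2) L_n on the half-line, against L_0 = 1 and
  L_1 = 1 - x. The moments \<open>fact i\<close> cancel the denominators and leave alternating
  binomial sums.\<close>

lemma laguerre_integral:
  assumes j: "j \<le> 1"
  shows "has_bochner_integral lborel
    (\<lambda>x. if x < 0 then 0 else exp (- (x / 2)) * laguerre n x * (exp (- (x / 2)) * (1 - real j * x)))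
    (if n = j then 1 else 0)"
proof -
  define w where "w = (\<lambda>i. real (n choose i) / fact i * (- 1) ^ i)"
  have "has_bochner_integral lborel (\<lambda>x. \<Sum>i\<le>n. w i * (exp_moment i 1 x - real j * exp_moment (Suc i) 1 x))
    (\<Sum>i\<le>n. w i * (fact i / 1 ^ Suc i - real j * (fact (Suc i) / 1 ^ Suc (Suc i))))"
    by (intro has_bochner_integral_sum has_bochner_integral_mult_right has_bochner_integral_diff exp_moment_integral) auto
  also have "(\<lambda>x. \<Sum>i\<le>n. w i * (exp_moment i 1 x - real j * exp_moment (Suc i) 1 x))
     = (\<lambda>x. if x < 0 then 0 else exp (- (x / 2)) * laguerre n x * (exp (- (x / 2)) * (1 - real j * x)))"
  proof
    fix x :: real
    have e: "exp (- x) = exp (- (x / 2)) * exp (- (x / 2))" by (simp flip: exp_add)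
    have "(\<Sum>i\<le>n. w i * (x ^ i * exp (- x) - real j * (x ^ Suc i * exp (- x))))
        = (\<Sum>i\<le>n. real (n choose i) / fact i * (- x) ^ i) * (exp (- x) * (1 - real j * x))"
      unfolding sum_distrib_right
      by (intro sum.cong refl) (simp add: w_def power_minus[of x] algebra_simps diff_divide_distrib)
    then show "(\<Sum>i\<le>n. w i * (exp_moment i 1 x - real j * exp_moment (Suc i) 1 x))
      = (if x < 0 then 0 else exp (- (x / 2)) * laguerre n x * (exp (- (x / 2)) * (1 - real j * x)))"
      unfolding laguerre_def[symmetric] e by (simp add: exp_moment_def e mult_ac)
  qed
  also have "(\<Sum>i\<le>n. w i * (fact i / 1 ^ Suc i - real j * (fact (Suc i) / 1 ^ Suc (Suc i))))
     = (\<Sum>i\<le>n. (- 1) ^ i * real (n choose i)) * (1 - real j) - real j * (\<Sum>i\<le>n. (- 1) ^ i * real i * real (n choose i))"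
    unfolding sum_distrib_right sum_distrib_left sum_subtractf[symmetric]
    by (intro sum.cong refl) (simp add: w_def field_simps)
  also have "\<dots> = (if n = j then 1 else 0)"
  proof -
    consider "j = 0" | "j = 1" using j by linarith
    then show ?thesis
    proof cases
      case 1
      then show ?thesis using choose_alternating_sum[of n, where 'a = real] by (cases "n = 0") auto
    next
      case 2
      then show ?thesis using choose_alternating_linear_sum[of n, where 'a = real] by (cases "n = 1") auto
    qed
  qed
  finally show ?thesis .
qed

text \<open>The trace is the series of \<open>p n\<close> times exp (- x / 2) L_n with x =
  |\<xi>|^2; integration against the \<open>j\<close>-th function isolates \<open>p j\<close>. The
  left side is the integral of (1 - b x) (1 - j x) exp (- l x), convergent because
  \<open>t > -1\<close>.\<close>

lemma radial_state_diagonal: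
  assumes \<sigma>: "pos_tc \<sigma>" and j: "j \<le> 1" and t: "-1 < t"
    and tr: "\<And>\<xi>. tr_mul \<sigma> (disp \<xi>) = of_real ((1 - b * (cmod \<xi>)\<^sup>2) * exp (- (t * (cmod \<xi>)\<^sup>2 / 2)))"
  defines "l \<equiv> (t + 1) / 2"
  shows "1 / l - (b + real j) / l\<^sup>2 + 2 * b * real j / l ^ 3 = Re (\<sigma> j j)"
proof -
  have l: "0 < l" using t by (simp add: l_def)
  define p where "p = (\<lambda>n. Re (\<sigma> n n))"
  have p: "0 \<le> p n" "\<sigma> n n = of_real (p n)" for n
    using pos_tcD(3)[OF \<sigma>] pos_form_diag(3)[OF pos_tcD(1)[OF \<sigma>]] by (simp_all add: p_def)
  have psum: "summable p" using pos_tcD(2)[OF \<sigma>] by (simp add: p_def sums_iff)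
  define h where "h = (\<lambda>x. exp (- (x / 2)) * (1 - real j * x))"
  define f where "f = (\<lambda>n x. if x < 0 then 0 else exp (- (x / 2)) * laguerre n x * h x)"
  define F where "F = (\<lambda>x. if x < 0 then 0 else (1 - b * x) * exp (- (t * x / 2)) * h x)"
  \<comment> \<open>A majorant independent of \<open>n\<close>, from \<open>laguerre_bound\<close>
    and \<open>1 + x\<close>; with summable \<open>p\<close> it justifies termwise
    integration.\<close>
  define B where "B = (\<lambda>x. exp_moment 0 (1/2) x + exp_moment 1 (1/2) x)"
  have sums: "(\<lambda>n. p n * f n x) sums F x" for x
  proof (cases "x < 0")
    case False
    then have x: "(cmod (of_real (sqrt x)))\<^sup>2 = x" by simp
    have "(\<lambda>n. \<sigma> n n * disp (of_real (sqrt x)) n n) sums tr_mul \<sigma> (disp (of_real (sqrt x)))"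
      by (rule radial_tr_mul_sums[OF \<sigma>]) (simp add: tr norm_mult)
    then have "(\<lambda>n. complex_of_real (p n * (exp (- (x / 2)) * laguerre n x))) sums of_real ((1 - b * x) * exp (- (t * x / 2)))"
      unfolding tr disp_diag p(2) x by simp
    then have "(\<lambda>n. p n * (exp (- (x / 2)) * laguerre n x)) sums ((1 - b * x) * exp (- (t * x / 2)))"
      by (simp only: sums_of_real_iff)
    from sums_mult2[OF this, of "h x"] show ?thesis using False by (simp add: f_def F_def mult_ac)
  qed (simp add: f_def F_def)
  have fB: "\<bar>f n x\<bar> \<le> B x" for n x
  proof (cases "x < 0")
    case False
    have "\<bar>exp (- (x / 2)) * laguerre n x\<bar> * \<bar>h x\<bar> \<le> 1 * \<bar>h x\<bar>"
      using laguerre_bound[of x n] False by (intro mult_right_mono) auto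
    moreover have "\<bar>h x\<bar> \<le> exp (- (x / 2)) * (1 + x)"
    proof -
      have "j = 0 \<or> j = 1" using j by linarith
      then have "\<bar>1 - real j * x\<bar> \<le> 1 + x" using False by auto
      then show ?thesis unfolding h_def abs_mult by (auto intro!: mult_mono)
    qed
    ultimately show ?thesis using False
      by (simp add: f_def B_def exp_moment_def abs_mult algebra_simps)
  qed (simp add: f_def B_def exp_moment_def)
  have Bint: "integrable lborel B"
    unfolding B_def
    by (intro Bochner_Integration.integrable_add integrable.intros[OF exp_moment_integral]) auto
  have fint: "has_bochner_integral lborel (f n) (if n = j then 1 else 0)" for n
    unfolding f_def h_def by (rule laguerre_integral[OF j])
  have int: "integrable lborel (\<lambda>x. p n * f n x)" for n
    using fint[of n] by (intro integrable_mult_right) (rule integrable.intros)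
  have "integral\<^sup>L lborel (\<lambda>x. \<Sum>n. p n * f n x) = (\<Sum>n. integral\<^sup>L lborel (\<lambda>x. p n * f n x))"
  proof (rule integral_suminf[OF int])
    show "AE x in lborel. summable (\<lambda>n. norm (p n * f n x))"
    proof (intro AE_I2 summable_comparison_test[OF _ summable_mult2[OF psum]] exI allI impI)
      fix n x show "norm (norm (p n * f n x)) \<le> p n * B x"
        using mult_left_mono[OF fB p(1)] p(1) by (simp add: abs_mult)
    qed
    show "summable (\<lambda>n. LINT x|lborel. norm (p n * f n x))"
    proof (intro summable_comparison_test[OF _ summable_mult2[OF psum]] exI allI impI)
      fix n
      have "(LINT x|lborel. norm (p n * f n x)) \<le> (LINT x|lborel. p n * B x)"
        using mult_left_mono[OF fB p(1)] p(1) int[of n] Bint by (intro integral_mono) (auto simp: abs_mult)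
      then show "norm (LINT x|lborel. norm (p n * f n x)) \<le> p n * (LINT x|lborel. B x)" by simp
    qed
  qed
  also have "(\<lambda>x. \<Sum>n. p n * f n x) = F" using sums by (simp add: sums_iff fun_eq_iff)
  also have "(\<lambda>n. integral\<^sup>L lborel (\<lambda>x. p n * f n x)) = (\<lambda>n. if n = j then p j else 0)"
    using has_bochner_integral_integral_eq[OF fint] by (auto simp: fun_eq_iff)
  also have "(\<Sum>n. if n = j then p j else 0) = p j" by (rule sums_unique[symmetric, OF sums_single])
  finally have Fp: "integral\<^sup>L lborel F = p j" .
  have "has_bochner_integral lborel (\<lambda>x. exp_moment 0 l x - (b + real j) * exp_moment 1 l x + b * real j * exp_moment 2 l x)
    (fact 0 / l ^ Suc 0 - (b + real j) * (fact 1 / l ^ Suc 1) + b * real j * (fact 2 / l ^ Suc 2))"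
    by (intro has_bochner_integral_add has_bochner_integral_diff has_bochner_integral_mult_right exp_moment_integral l)
  also have "(\<lambda>x. exp_moment 0 l x - (b + real j) * exp_moment 1 l x + b * real j * exp_moment 2 l x) = F"
  proof
    fix x
    have "exp (- l * x) = exp (- (t * x / 2)) * exp (- (x / 2))"
      unfolding exp_add[symmetric] by (simp add: l_def field_simps)
    then show "exp_moment 0 l x - (b + real j) * exp_moment 1 l x + b * real j * exp_moment 2 l x = F x"
      by (simp add: F_def h_def exp_moment_def power2_eq_square algebra_simps)
  qed
  finally have "integral\<^sup>L lborel F = fact 0 / l ^ Suc 0 - (b + real j) * (fact 1 / l ^ Suc 1) + b * real j * (fact 2 / l ^ Suc 2)"
    by (rule has_bochner_integral_integral_eq)
  then show ?thesis using Fp by (simp add: p_def power2_eq_square power3_eq_cube fact_2 mult_ac)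
qed

section \<open>Fock states as test inputs\<close>

definition fock :: "nat \<Rightarrow> cmat" where
  "fock j m n = (if m = j \<and> n = j then 1 else 0)"

lemma fock_sums: "(\<lambda>n. fock j n n) sums 1"
proof -
  have "(\<lambda>n. fock j n n) = (\<lambda>n. if n = j then 1 else 0)" by (auto simp: fock_def)
  then show ?thesis using sums_single[of j "\<lambda>_. 1 :: complex"] by simp
qed

lemma density_op_fock: "density_op (fock j)"
proof -
  have "pos_form (fock j)"
    unfolding pos_form_def
  proof (intro conjI allI impI)
    fix S :: "nat set" and v :: "nat \<Rightarrow> complex"
    assume S: "finite S"
    have "(\<Sum>x\<in>S. \<Sum>y\<in>S. cnj (v x) * fock j x y * v y) = (\<Sum>x\<in>S. \<Sum>y\<in>S. if y = j then (if x = j then cnj (v j) * v j else 0) else 0)"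
      by (intro sum.cong refl) (auto simp: fock_def)
    also have "\<dots> = (if j \<in> S then cnj (v j) * v j else 0)"
      using S by (simp add: sum.delta)
    finally show "0 \<le> Re (\<Sum>x\<in>S. \<Sum>y\<in>S. cnj (v x) * fock j x y * v y)" by simp
  qed (simp add: fock_def)
  then show ?thesis
    using fock_sums[of j] by (simp add: density_op_def pos_tc_def psd_mat_iff_pos_form mat_trace_def sums_iff)
qed

lemma tr_mul_fock: "tr_mul (fock j) B = B j j"
proof -
  have "(\<Sum>m. fock j n m * B m n) = (if n = j then B j j else 0)" for n
  proof -
    have "(\<lambda>m. fock j n m * B m n) = (\<lambda>m. if m = j then (if n = j then B j j else 0) else 0)"
      by (auto simp: fock_def)
    then show ?thesis using sums_unique[OF sums_single[of j "\<lambda>_. if n = j then B j j else 0"]] by simp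
  qed
  then show ?thesis
    unfolding tr_mul_def using sums_unique[OF sums_single[of j "\<lambda>_. B j j"]] by simp
qed

text \<open>For \<open>i \<le> 1\<close> the Laguerre factor of the input is
  \<open>1 - i * x\<close>, which scaling turns into \<open>1 - b * x\<close>. Collecting the
  Gaussian factors of input and ordering gives the exponent
  \<open>s + a\<^sup>2 * (1 - s)\<close>.\<close>

lemma scaling_positive_diagonal:
  assumes pos: "scaling_positive s a" and i: "i \<le> 1" and j: "j \<le> 1" and t: "- 1 < s + a\<^sup>2 * (1 - s)"
  defines "l \<equiv> (s + a\<^sup>2 * (1 - s) + 1) / 2" and "b \<equiv> real i * a\<^sup>2"
  shows "0 \<le> 1 / l - (b + real j) / l\<^sup>2 + 2 * b * real j / l ^ 3"
proof -
  obtain \<sigma> where \<sigma>: "density_op \<sigma>" and chi: "\<And>\<xi>. chi s \<xi> \<sigma> = chi s (of_real a * \<xi>) (fock i)"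
    using pos density_op_fock unfolding scaling_positive_def by blast
  have tc: "pos_tc \<sigma>" using \<sigma> by (simp add: density_op_def)
  have lag: "laguerre i x = 1 - real i * x" for x
    using i by (cases i) (auto simp: laguerre_def)
  have "tr_mul \<sigma> (disp \<xi>) = of_real ((1 - b * (cmod \<xi>)\<^sup>2) * exp (- ((s + a\<^sup>2 * (1 - s)) * (cmod \<xi>)\<^sup>2 / 2)))" for \<xi>
  proof -
    define z where "z = (cmod \<xi>)\<^sup>2"
    have az: "(cmod (of_real a * \<xi>))\<^sup>2 = a\<^sup>2 * z" by (simp add: z_def norm_mult power_mult_distrib)
    have "of_real (exp (s * z / 2)) * tr_mul \<sigma> (disp \<xi>)
       = of_real (exp (s * (a\<^sup>2 * z) / 2) * (exp (- (a\<^sup>2 * z / 2)) * (1 - real i * (a\<^sup>2 * z))))"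
      using chi[of \<xi>] unfolding chi_def tr_mul_fock disp_diag az lag by (simp add: z_def)
    then have "of_real (exp (- (s * z / 2))) * (of_real (exp (s * z / 2)) * tr_mul \<sigma> (disp \<xi>))
       = of_real (exp (- (s * z / 2)) * (exp (s * (a\<^sup>2 * z) / 2) * (exp (- (a\<^sup>2 * z / 2)) * (1 - real i * (a\<^sup>2 * z)))))"
      by (simp only: of_real_mult)
    moreover have "exp (- (s * z / 2)) * (exp (s * (a\<^sup>2 * z) / 2) * (exp (- (a\<^sup>2 * z / 2)) * (1 - real i * (a\<^sup>2 * z))))
       = (1 - b * z) * exp (- ((s + a\<^sup>2 * (1 - s)) * z / 2))"
    proof -
      have "exp (- ((s + a\<^sup>2 * (1 - s)) * z / 2)) = exp (- (s * z / 2)) * (exp (s * (a\<^sup>2 * z) / 2) * exp (- (a\<^sup>2 * z / 2)))"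
        unfolding exp_add[symmetric] by (simp add: field_simps)
      then show ?thesis by (simp add: b_def mult_ac)
    qed
    moreover have "of_real (exp (- (s * z / 2))) * (of_real (exp (s * z / 2)) * tr_mul \<sigma> (disp \<xi>)) = tr_mul \<sigma> (disp \<xi>)"
    proof -
      have "exp (- (s * z / 2)) * exp (s * z / 2) = 1" by (simp flip: exp_add)
      then show ?thesis unfolding mult.assoc[symmetric] of_real_mult[symmetric] by simp
    qed
    ultimately show ?thesis by (simp only: z_def)
  qed
  from radial_state_diagonal[OF tc j t this] show ?thesis
    using pos_tcD(3)[OF tc, of j] unfolding l_def by simp
qed

theorem theorem1:
  fixes s a :: real
  assumes "-1 \<le> s" and "s \<le> 1" and "a \<noteq> 0"
  shows "(\<bar>a\<bar> = 1 \<or> (s = -1 \<and> \<bar>a\<bar> > 1) \<or> (s = 1 \<and> \<bar>a\<bar> < 1) \<longrightarrow> scaling_CP s a) \<and>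
         (\<not> (\<bar>a\<bar> = 1 \<or> (s = -1 \<and> \<bar>a\<bar> > 1) \<or> (s = 1 \<and> \<bar>a\<bar> < 1)) \<longrightarrow> \<not> scaling_positive s a)"
proof (intro conjI impI)
  assume "\<bar>a\<bar> = 1 \<or> (s = -1 \<and> \<bar>a\<bar> > 1) \<or> (s = 1 \<and> \<bar>a\<bar> < 1)"
  then show "scaling_CP s a"
    using scaling_CP_unit scaling_CP_amp scaling_CP_att[of a] by auto
next
  assume not_CP: "\<not> (\<bar>a\<bar> = 1 \<or> (s = -1 \<and> \<bar>a\<bar> > 1) \<or> (s = 1 \<and> \<bar>a\<bar> < 1))"
  define l where "l = (s + a\<^sup>2 * (1 - s) + 1) / 2"
  show "\<not> scaling_positive s a"
  proof
    assume pos: "scaling_positive s a"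
    consider "\<bar>a\<bar> < 1" "s < 1" | "\<bar>a\<bar> > 1" "- 1 < s" using not_CP assms by linarith
    then show False
    proof cases
      case 1
      then have a2: "0 < a\<^sup>2" "a\<^sup>2 < 1" using assms(3) by (auto simp: abs_square_less_1)
      then have "0 < a\<^sup>2 * (1 - s)" using 1 by simp
      then have l: "0 < l" "- 1 < s + a\<^sup>2 * (1 - s)" using assms by (auto simp: l_def)
      \<comment> \<open>This product is \<open>2 * (l - 1)\<close>.\<close>
      have "(a\<^sup>2 - 1) * (1 - s) < 0" using a2 1 by (intro mult_neg_pos) auto
      then have "l < 1" by (simp add: l_def algebra_simps)
      have "0 \<le> 1 / l - 1 / l\<^sup>2"
        using scaling_positive_diagonal[OF pos, of 0 1] l by (simp add: l_def)
      then have "0 \<le> (1 / l - 1 / l\<^sup>2) * l\<^sup>2" by simp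
      also have "\<dots> = l - 1" using l by (simp add: field_simps power2_eq_square)
      finally show False using \<open>l < 1\<close> by simp
    next
      case 2
      then have a2: "1 < a\<^sup>2" using one_less_power[of "\<bar>a\<bar>" 2] by simp
      then have "1 * (1 - s) \<le> a\<^sup>2 * (1 - s)" using assms by (intro mult_right_mono) auto
      then have l: "0 < l" "- 1 < s + a\<^sup>2 * (1 - s)" by (auto simp: l_def)
      \<comment> \<open>This product is \<open>2 * (l - a\<^sup>2)\<close>.\<close>
      have "(1 - a\<^sup>2) * (s + 1) < 0" using a2 2 by (intro mult_neg_pos) auto
      then have "l < a\<^sup>2" by (simp add: l_def algebra_simps)
      have "0 \<le> 1 / l - a\<^sup>2 / l\<^sup>2"
        using scaling_positive_diagonal[OF pos, of 1 0] l by (simp add: l_def)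
      then have "0 \<le> (1 / l - a\<^sup>2 / l\<^sup>2) * l\<^sup>2" by simp
      also have "\<dots> = l - a\<^sup>2" using l by (simp add: field_simps power2_eq_square)
      finally show False using \<open>l < a\<^sup>2\<close> by simp
    qed
  qed
qed

end
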